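(* For every skew partition $\lambda/\mu$, $\mathrm{zrank}(\lambda/\mu)=\mathrm{rank}(\lambda/\mu)$.
   Context: Partitions are identified with Young diagrams (English convention); the square $(i,j)$ lies in row $i$ and column $j$ and has content $j-i$. For partitions $\mu\subseteq\lambda$, the skew diagram $\lambda/\mu$ consists of the squares of $\lambda$ not in $\mu$. A square $(i,j)$ is an inner corner of $\lambda/\mu$ if $(i,j),(i,j-1),(i-1,j)\in\lambda/\mu$ but $(i-1,j-1)\notin\lambda/\mu$; it is an outer corner if $(i,j)\in\lambda/\mu$ but $(i-1,j-1),(i,j-1),(i-1,j)\notin\lambda/\mu$. The inner (resp. outer) diagonal of an inner (resp. outer) corner $(i,j)$ consists of all squares $(i+p,j+p)\in\lambda/\mu$, $p\ge 0$. Let $d^+$ be the total number of squares on all outer diagonals and $d^-$ the total number on all inner diagonals; $\mathrm{rank}(\lambda/\mu)=d^+-d^-$. Let $s_{\lambda/\mu}$ be the skew Schur function and $s_{\lambda/\mu}(1^t)$ its specialization $x_1=\cdots=x_t=1$, $x_i=0$ for $i>t$ (a polynomial in $t$). Then $\mathrm{zrank}(\lambda/\mu)$ is the exponent of the largest power of $t$ dividing $s_{\lambda/\mu}(1^t)$. *)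

theory Defs
  imports
    "HOL-Library.Poly_Mapping"
    "HOL-Computational_Algebra.Polynomial"
begin

definition is_partition :: "nat list \<Rightarrow> bool" where
  "is_partition lam \<longleftrightarrow> sorted_wrt (\<ge>) lam \<and> 0 \<notin> set lam"

text \<open>Squares are pairs (row, column), both counted from 1 as in the English convention. Hence no
  diagram contains a square with a coordinate 0, and the truncated subtractions in the definitions
  of corners below are harmless.\<close>

definition young_diagram :: "nat list \<Rightarrow> (nat \<times> nat) set" where
  "young_diagram lam = {(i, j). 1 \<le> i \<and> i \<le> length lam \<and> 1 \<le> j \<and> j \<le> lam ! (i - 1)}"

definition skew_diagram :: "nat list \<Rightarrow> nat list \<Rightarrow> (nat \<times> nat) set" where
  "skew_diagram lam mu = young_diagram lam - young_diagram mu"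

definition inner_corners :: "(nat \<times> nat) set \<Rightarrow> (nat \<times> nat) set" where
  "inner_corners D = {(i, j). (i, j) \<in> D \<and> (i, j - 1) \<in> D \<and> (i - 1, j) \<in> D \<and> (i - 1, j - 1) \<notin> D}"

definition outer_corners :: "(nat \<times> nat) set \<Rightarrow> (nat \<times> nat) set" where
  "outer_corners D = {(i, j). (i, j) \<in> D \<and> (i - 1, j - 1) \<notin> D \<and> (i, j - 1) \<notin> D \<and> (i - 1, j) \<notin> D}"

definition diagonal_from :: "(nat \<times> nat) set \<Rightarrow> nat \<times> nat \<Rightarrow> (nat \<times> nat) set" where
  "diagonal_from D c = {(fst c + p, snd c + p) | p. (fst c + p, snd c + p) \<in> D}"

definition d_plus :: "(nat \<times> nat) set \<Rightarrow> nat" where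
  "d_plus D = card (\<Union>c\<in>outer_corners D. diagonal_from D c)"

definition d_minus :: "(nat \<times> nat) set \<Rightarrow> nat" where
  "d_minus D = card (\<Union>c\<in>inner_corners D. diagonal_from D c)"

definition skew_rank :: "nat list \<Rightarrow> nat list \<Rightarrow> int" where
  "skew_rank lam mu = int (d_plus (skew_diagram lam mu)) - int (d_minus (skew_diagram lam mu))"

text \<open>Semistandard Young tableaux of shape \<open>D\<close>, with entries in the positive integers. A filling is
  made a total function by the value 0 outside \<open>D\<close>, so that each tableau is counted once.\<close>

definition ssyt :: "(nat \<times> nat) set \<Rightarrow> (nat \<times> nat \<Rightarrow> nat) set" where
  "ssyt D = {T.
     (\<forall>s\<in>D. 1 \<le> T s) \<and> (\<forall>s. s \<notin> D \<longrightarrow> T s = 0) \<and>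
     (\<forall>i j j'. (i, j) \<in> D \<and> (i, j') \<in> D \<and> j < j' \<longrightarrow> T (i, j) \<le> T (i, j')) \<and>
     (\<forall>i i' j. (i, j) \<in> D \<and> (i', j) \<in> D \<and> i < i' \<longrightarrow> T (i, j) < T (i', j))}"

text \<open>A formal power series in \<open>x\<^sub>1, x\<^sub>2, \<dots>\<close> is given by its coefficients; the exponent vector of a
  monomial is a finitely supported function on the indices of the variables. The skew Schur function
  is the generating function of the tableaux: the coefficient of \<open>x\<^sup>\<alpha>\<close> is the number of tableaux
  in which each \<open>k\<close> occurs \<open>\<alpha> k\<close> times.\<close>

definition skew_schur :: "nat list \<Rightarrow> nat list \<Rightarrow> (nat \<Rightarrow>\<^sub>0 nat) \<Rightarrow> rat" where
  "skew_schur lam mu \<alpha> = of_nat (card {T \<in> ssyt (skew_diagram lam mu).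
     \<forall>k. card {s \<in> skew_diagram lam mu. T s = k} = Poly_Mapping.lookup \<alpha> k})"

text \<open>Substitution of numbers for the variables. \<open>Sum_any\<close> sums over all exponent vectors, and is
  meaningful when only finitely many terms are nonzero, in particular when the series is
  homogeneous and almost all \<open>x i\<close> are 0.\<close>

definition series_eval :: "((nat \<Rightarrow>\<^sub>0 nat) \<Rightarrow> rat) \<Rightarrow> (nat \<Rightarrow> rat) \<Rightarrow> rat" where
  "series_eval f x = Sum_any (\<lambda>\<alpha>. f \<alpha> * (\<Prod>i\<in>Poly_Mapping.keys \<alpha>. x i ^ Poly_Mapping.lookup \<alpha> i))"

definition ones :: "nat \<Rightarrow> nat \<Rightarrow> rat" where
  "ones t i = (if 1 \<le> i \<and> i \<le> t then 1 else 0)"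

text \<open>The polynomial in \<open>t\<close> whose values at the natural numbers are the specializations
  \<open>x\<^sub>1 = \<dots> = x\<^sub>t = 1\<close>, \<open>x\<^sub>i = 0\<close> for \<open>i > t\<close>.\<close>

definition skew_schur_poly :: "nat list \<Rightarrow> nat list \<Rightarrow> rat poly" where
  "skew_schur_poly lam mu =
     (THE p. \<forall>t::nat. poly p (of_nat t) = series_eval (skew_schur lam mu) (ones t))"

definition zrank :: "nat list \<Rightarrow> nat list \<Rightarrow> nat" where
  "zrank lam mu = order 0 (skew_schur_poly lam mu)"

end

theory Submission
  imports Defs "Jordan_Normal_Form.Char_Poly"
begin

text \<open>Put \<open>l\<^sub>i = \<lambda>\<^sub>i - i\<close> and \<open>m\<^sub>j = \<mu>\<^sub>j - j\<close>. By the Jacobi-Trudi identity the specialization is the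
  determinant of the matrix with entries \<open>h\<close> of index \<open>l\<^sub>i - m\<^sub>j\<close>, where \<open>h\<close> of index \<open>k\<close> is 1 for
  \<open>k = 0\<close>, 0 for \<open>k < 0\<close> and \<open>t / k + O(t\<^sup>2)\<close> for \<open>k > 0\<close>. If \<open>r\<close> rows have no entry 1, the coefficient
  of \<open>t\<^sup>r\<close> is up to sign a determinant with entries \<open>1 / (x\<^sub>i - y\<^sub>j)\<close> where \<open>x\<^sub>i > y\<^sub>j\<close> and 0 elsewhere;
  Dodgson condensation determines its sign, so it is nonzero. Finally \<open>r\<close> is the rank, because
  an outer (inner) diagonal of content \<open>c\<close> is recognized by whether \<open>c\<close> and \<open>c + 1\<close> occur among the
  numbers \<open>\<mu>\<^sub>j - j + 1\<close>.\<close>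

section \<open>Determinants\<close>

text \<open>The matrix is a total function of which only the entries below \<open>n\<close> count,
  so that a minor is a mere reindexing by \<open>Suc\<close> or \<open>insert_index\<close>.\<close>

definition fdet :: "nat \<Rightarrow> (nat \<Rightarrow> nat \<Rightarrow> 'a::comm_ring_1) \<Rightarrow> 'a" where
  "fdet n f = det (mat n n (\<lambda>(i, j). f i j))"

lemma fdet_cong:
  assumes "\<And>i j. i < n \<Longrightarrow> j < n \<Longrightarrow> f i j = g i j"
  shows "fdet n f = fdet n g"
proof -
  have "mat n n (\<lambda>(i, j). f i j) = mat n n (\<lambda>(i, j). g i j)"
    using assms by (intro eq_matI) auto
  then show ?thesis
    by (simp add: fdet_def)
qed

lemma fdet_leibniz:
  "fdet n f = (\<Sum>p | p permutes {..<n}. signof p * (\<Prod>i<n. f i (p i)))"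
proof -
  have "fdet n f = (\<Sum>p | p permutes {0..<n}. signof p * (\<Prod>i = 0..<n. mat n n (\<lambda>(i, j). f i j) $$ (i, p i)))"
    unfolding fdet_def by (rule det_def') simp
  also have "\<dots> = (\<Sum>p | p permutes {0..<n}. signof p * (\<Prod>i = 0..<n. f i (p i)))"
    by (intro sum.cong prod.cong refl arg_cong2[of _ _ _ _ "(*)"]) (auto dest: permutes_in_image)
  finally show ?thesis
    by (simp add: atLeast0LessThan)
qed

lemma fdet_column:
  assumes "j < Suc n"
  shows "fdet (Suc n) f =
    (\<Sum>i<Suc n. f i j * ((- 1) ^ (i + j) * fdet n (\<lambda>i' j'. f (insert_index i i') (insert_index j j'))))"
proof -
  let ?A = "mat (Suc n) (Suc n) (\<lambda>(i, j). f i j)"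
  have "mat_delete ?A i j = mat n n (\<lambda>(i', j'). f (insert_index i i') (insert_index j j'))"
    if "i < Suc n" for i
    unfolding mat_delete_def insert_index_def by (rule eq_matI) (use that assms in auto)
  then have "cofactor ?A i j = (- 1) ^ (i + j) * fdet n (\<lambda>i' j'. f (insert_index i i') (insert_index j j'))"
    if "i < Suc n" for i
    using that by (simp add: cofactor_def fdet_def)
  moreover have "fdet (Suc n) f = (\<Sum>i<Suc n. ?A $$ (i, j) * cofactor ?A i j)"
    unfolding fdet_def by (rule laplace_expansion_column) (use assms in auto)
  ultimately show ?thesis
    using assms by simp
qed

lemma fdet_row:
  assumes "i < Suc n"
  shows "fdet (Suc n) f =
    (\<Sum>j<Suc n. f i j * ((- 1) ^ (i + j) * fdet n (\<lambda>i' j'. f (insert_index i i') (insert_index j j'))))"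
proof -
  let ?A = "mat (Suc n) (Suc n) (\<lambda>(i, j). f i j)"
  have "mat_delete ?A i j = mat n n (\<lambda>(i', j'). f (insert_index i i') (insert_index j j'))"
    if "j < Suc n" for j
    unfolding mat_delete_def insert_index_def by (rule eq_matI) (use that assms in auto)
  then have "cofactor ?A i j = (- 1) ^ (i + j) * fdet n (\<lambda>i' j'. f (insert_index i i') (insert_index j j'))"
    if "j < Suc n" for j
    using that by (simp add: cofactor_def fdet_def)
  moreover have "fdet (Suc n) f = (\<Sum>j<Suc n. ?A $$ (i, j) * cofactor ?A i j)"
    unfolding fdet_def by (rule laplace_expansion_row) (use assms in auto)
  ultimately show ?thesis
    using assms by simp
qed

lemma fdet_column_single:
  assumes "i < Suc n" "j < Suc n" "\<And>k. k < Suc n \<Longrightarrow> k \<noteq> i \<Longrightarrow> f k j = 0"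
  shows "fdet (Suc n) f =
    f i j * ((- 1) ^ (i + j) * fdet n (\<lambda>i' j'. f (insert_index i i') (insert_index j j')))"
  unfolding fdet_column[OF assms(2)]
  using assms by (subst sum.remove[of _ i]) (auto intro!: sum.neutral)

lemma fdet_row_single:
  assumes "i < Suc n" "j < Suc n" "\<And>k. k < Suc n \<Longrightarrow> k \<noteq> j \<Longrightarrow> f i k = 0"
  shows "fdet (Suc n) f =
    f i j * ((- 1) ^ (i + j) * fdet n (\<lambda>i' j'. f (insert_index i i') (insert_index j j')))"
  unfolding fdet_row[OF assms(1)]
  using assms by (subst sum.remove[of _ j]) (auto intro!: sum.neutral)

section \<open>Products, triangular matrices and zero blocks\<close>

lemma fdet_mult:
  "fdet n f * fdet n g = fdet n (\<lambda>i j. \<Sum>k<n. f i k * g k j)"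
proof -
  have "fdet n f * fdet n g = det (mat n n (\<lambda>(i, j). f i j) * mat n n (\<lambda>(i, j). g i j))"
    unfolding fdet_def by (rule det_mult[symmetric]) auto
  also have "mat n n (\<lambda>(i, j). f i j) * mat n n (\<lambda>(i, j). g i j)
      = mat n n (\<lambda>(i, j). \<Sum>k<n. f i k * g k j)"
    by (rule eq_matI) (auto simp: scalar_prod_def atLeast0LessThan)
  finally show ?thesis
    by (simp add: fdet_def)
qed

lemma fdet_0 [simp]: "fdet 0 f = 1"
  by (simp add: fdet_leibniz)

lemma fdet_2: "fdet (Suc (Suc 0)) f = f 0 0 * f 1 1 - f 0 1 * f 1 0"
  by (simp add: fdet_row[of 0] insert_index_def)

lemma insert_index_0 [simp]: "insert_index 0 = Suc"
  by (auto simp: insert_index_def)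

lemma fdet_upper_triangular:
  assumes "\<And>i j. i < n \<Longrightarrow> j < i \<Longrightarrow> f i j = 0"
  shows "fdet n f = (\<Prod>i<n. f i i)"
  using assms
proof (induction n arbitrary: f)
  case (Suc n)
  have "fdet (Suc n) f = f 0 0 * fdet n (\<lambda>i j. f (Suc i) (Suc j))"
    by (subst fdet_column_single[of 0 _ 0]) (use Suc.prems in auto)
  also have "fdet n (\<lambda>i j. f (Suc i) (Suc j)) = (\<Prod>i<n. f (Suc i) (Suc i))"
    by (rule Suc.IH) (use Suc.prems in auto)
  finally show ?case
    by (simp only: prod.lessThan_Suc_shift)
qed simp

lemma fdet_lower_triangular:
  assumes "\<And>i j. j < n \<Longrightarrow> i < j \<Longrightarrow> f i j = 0"
  shows "fdet n f = (\<Prod>i<n. f i i)"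
  using assms
proof (induction n arbitrary: f)
  case (Suc n)
  have "fdet (Suc n) f = f 0 0 * fdet n (\<lambda>i j. f (Suc i) (Suc j))"
    by (subst fdet_row_single[of 0 _ 0]) (use Suc.prems in auto)
  also have "fdet n (\<lambda>i j. f (Suc i) (Suc j)) = (\<Prod>i<n. f (Suc i) (Suc i))"
    by (rule Suc.IH) (use Suc.prems in auto)
  finally show ?case
    by (simp only: prod.lessThan_Suc_shift)
qed simp

lemma fdet_scale:
  "fdet n (\<lambda>i j. r i * c j * f i j) = (\<Prod>i<n. r i) * (\<Prod>j<n. c j) * fdet n f"
proof -
  have "(\<Prod>i<n. r i * c (p i) * f i (p i)) = (\<Prod>i<n. r i) * (\<Prod>j<n. c j) * (\<Prod>i<n. f i (p i))"
    if "p permutes {..<n}" for p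
    by (simp add: prod.distrib prod.permute[OF that, of c] o_def)
  then show ?thesis
    unfolding fdet_leibniz sum_distrib_left by (intro sum.cong) (auto simp: mult_ac)
qed

text \<open>Pigeonhole: a nonzero Leibniz term would map the \<open>n - k\<close> rows from
  \<open>k\<close> on injectively into the \<open>n - k - 1\<close> columns beyond
  \<open>k\<close>.\<close>

lemma fdet_zero_block:
  assumes "k < n" "\<And>i j. k \<le> i \<Longrightarrow> i < n \<Longrightarrow> j \<le> k \<Longrightarrow> f i j = 0"
  shows "fdet n f = 0"
proof -
  have "(\<Prod>i<n. f i (p i)) = 0" if p: "p permutes {..<n}" for p
  proof -
    have "\<exists>i\<in>{k..<n}. p i \<le> k"
    proof (rule ccontr)
      assume "\<not> ?thesis"
      then have "p ` {k..<n} \<subseteq> {Suc k..<n}"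
        using permutes_in_image[OF p] by (fastforce simp: Suc_le_eq not_le)
      moreover have "inj_on p {k..<n}"
        using permutes_inj_on[OF p] by blast
      ultimately have "card {k..<n} \<le> card {Suc k..<n}"
        by (metis card_inj_on_le finite_atLeastLessThan)
      then show False
        using assms(1) by simp
    qed
    then obtain i where "k \<le> i" "i < n" "p i \<le> k"
      by auto
    then show ?thesis
      using assms(2)[of i "p i"] by (auto intro!: prod_zero)
  qed
  then show ?thesis
    by (auto simp: fdet_leibniz intro!: sum.neutral)
qed

text \<open>Schur complement of the upper left entry: one step of Gaussian elimination, written as a
  factorization into \<open>L\<close> and \<open>M\<close>.\<close>

lemma fdet_pivot:
  fixes f :: "nat \<Rightarrow> nat \<Rightarrow> 'a::field"
  assumes "f 0 0 \<noteq> 0"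
  shows "fdet (Suc n) f =
    f 0 0 * fdet n (\<lambda>i j. f (Suc i) (Suc j) - f (Suc i) 0 * f 0 (Suc j) / f 0 0)"
proof -
  define L where "L i j = (if j = 0 then f i 0 / f 0 0 else if i = j then 1 else 0)" for i j :: nat
  define M where "M i j = (if i = 0 then f 0 j else f i j - f i 0 * f 0 j / f 0 0)" for i j
  have "fdet (Suc n) L = 1"
    by (subst fdet_lower_triangular) (auto simp: L_def assms intro!: prod.neutral)
  moreover have "fdet (Suc n) f = fdet (Suc n) (\<lambda>i j. \<Sum>k<Suc n. L i k * M k j)"
  proof (rule fdet_cong)
    fix i j
    assume "i < Suc n"
    then have "(\<Sum>k<Suc n. L i k * M k j) = (\<Sum>k\<in>{0, i}. L i k * M k j)"
      by (intro sum.mono_neutral_right) (auto simp: L_def)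
    also have "\<dots> = f i j"
      using assms by (cases "i = 0") (auto simp: L_def M_def)
    finally show "f i j = (\<Sum>k<Suc n. L i k * M k j)" ..
  qed
  ultimately have "fdet (Suc n) f = fdet (Suc n) M"
    by (simp only: fdet_mult[symmetric] mult_1)
  also have "\<dots> = f 0 0 * fdet n (\<lambda>i j. M (Suc i) (Suc j))"
    by (subst fdet_column_single[of 0 _ 0]) (use assms in \<open>auto simp: M_def\<close>)
  finally show ?thesis
    by (simp add: M_def)
qed

section \<open>Dodgson condensation\<close>

lemma fdet_middle_identity:
  "fdet (Suc (Suc n)) (\<lambda>i j. if j = 0 then p i else if j = Suc n then q i else if i = j then 1 else 0)
    = p 0 * q (Suc n) - p (Suc n) * q 0"
proof (induction n arbitrary: p q)
  case 0
  then show ?case by (simp add: fdet_2)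
next
  case (Suc n)
  let ?s = "insert_index (Suc 0)"
  let ?f = "\<lambda>i j. if j = 0 then p i else if j = Suc (Suc n) then q i else if i = j then 1 else 0"
  \<comment> \<open>Column 1 is a unit vector; deleting it together with row 1 leaves a matrix of
    the same form.\<close>
  have "fdet (Suc (Suc (Suc n))) ?f = fdet (Suc (Suc n)) (\<lambda>i j. ?f (?s i) (?s j))"
    by (subst fdet_column_single[of "Suc 0" _ "Suc 0"]) auto
  also have "\<dots> = fdet (Suc (Suc n)) (\<lambda>i j. if j = 0 then p (?s i)
      else if j = Suc n then q (?s i) else if i = j then 1 else 0)"
    by (rule fdet_cong) (auto simp: insert_index_def)
  also have "\<dots> = p 0 * q (Suc (Suc n)) - p (Suc (Suc n)) * q 0"
    by (subst Suc.IH) (simp add: insert_index_def)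
  finally show ?case .
qed

lemma fdet_hom_poly: "poly (fdet n f) x = fdet n (\<lambda>i j. poly (f i j) x)"
  by (simp add: fdet_leibniz poly_sum poly_prod sign_def)

text \<open>Jacobi's argument: in the identity matrix, replace the first and last columns by those
  of the adjugate. Multiplying \<open>f\<close> by this matrix \<open>X\<close> turns its own first
  and last columns into \<open>d\<close> times unit vectors, so the product has determinant
  \<open>d * d\<close> times the interior minor, while \<open>fdet N X\<close> is a 2 by 2 minor of
  the adjugate. One factor \<open>d\<close> is then cancelled.\<close>

lemma fdet_dodgson_nonzero:
  fixes f :: "nat \<Rightarrow> nat \<Rightarrow> 'a::idom"
  assumes nz: "fdet (Suc (Suc n)) f \<noteq> 0"
  shows "fdet (Suc (Suc n)) f * fdet n (\<lambda>i j. f (Suc i) (Suc j)) =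
    fdet (Suc n) f * fdet (Suc n) (\<lambda>i j. f (Suc i) (Suc j)) -
    fdet (Suc n) (\<lambda>i j. f (Suc i) j) * fdet (Suc n) (\<lambda>i j. f i (Suc j))"
proof -
  define N where "N = Suc (Suc n)"
  define A where "A = mat N N (\<lambda>(i, j). f i j)"
  define d where "d = fdet N f"
  define B where "B i j = adj_mat A $$ (i, j)" for i j
  have A: "A \<in> carrier_mat N N"
    by (simp add: A_def)
  have AB: "(\<Sum>k<N. f i k * B k j) = (if i = j then d else 0)" if "i < N" "j < N" for i j
  proof -
    have "(A * adj_mat A) $$ (i, j) = (\<Sum>k<N. f i k * B k j)"
      using that adj_mat(1)[OF A]
      by (auto simp: scalar_prod_def A_def B_def atLeast0LessThan)
    then show ?thesis
      using that adj_mat(2)[OF A] by (auto simp: d_def fdet_def simp flip: A_def)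
  qed
  have B: "B i j = (- 1) ^ (i + j) * fdet (Suc n) (\<lambda>i' j'. f (insert_index j i') (insert_index i j'))"
    if "i < N" "j < N" for i j
  proof -
    have "mat_delete A j i = mat (Suc n) (Suc n) (\<lambda>(i', j'). f (insert_index j i') (insert_index i j'))"
      unfolding mat_delete_def insert_index_def A_def by (rule eq_matI) (use that in \<open>auto simp: N_def\<close>)
    then show ?thesis
      using that by (simp add: B_def adj_mat_def A_def cofactor_def fdet_def add.commute)
  qed
  have last: "insert_index (Suc n) i = i" if "i < Suc n" for i
    using that by (simp add: insert_index_def)
  \<comment> \<open>The adjugate transposes: \<open>B 0 (Suc n)\<close> deletes the last row and the
    first column.\<close>
  have corners: "B 0 0 = fdet (Suc n) (\<lambda>i j. f (Suc i) (Suc j))"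
    "B (Suc n) (Suc n) = fdet (Suc n) f"
    "B 0 (Suc n) = (- 1) ^ Suc n * fdet (Suc n) (\<lambda>i j. f i (Suc j))"
    "B (Suc n) 0 = (- 1) ^ Suc n * fdet (Suc n) (\<lambda>i j. f (Suc i) j)"
    by (simp_all add: B N_def last cong: fdet_cong)
  define X where "X i j = (if j = 0 then B i 0 else if j = Suc n then B i (Suc n) else if i = j then 1 else 0)" for i j
  have "fdet N X = B 0 0 * B (Suc n) (Suc n) - B (Suc n) 0 * B 0 (Suc n)"
    unfolding X_def N_def by (rule fdet_middle_identity)
  also have "\<dots> = fdet (Suc n) f * fdet (Suc n) (\<lambda>i j. f (Suc i) (Suc j)) -
    fdet (Suc n) (\<lambda>i j. f (Suc i) j) * fdet (Suc n) (\<lambda>i j. f i (Suc j))" (is "_ = ?R")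
  proof -
    have s: "(- 1) ^ n * ((- 1) ^ n * x) = (x::'a)" for x
      by (simp flip: mult.assoc power_add)
    show ?thesis
      by (simp add: corners s mult_ac)
  qed
  finally have X: "fdet N X = ?R" .
  have "d * ?R = fdet N (\<lambda>i j. \<Sum>k<N. f i k * X k j)"
    unfolding X[symmetric] d_def by (rule fdet_mult)
  also have "\<dots> = fdet N (\<lambda>i j. if j = 0 then (if i = 0 then d else 0)
      else if j = Suc n then (if i = Suc n then d else 0) else f i j)"
  proof (rule fdet_cong)
    fix i j
    assume ij: "i < N" "j < N"
    show "(\<Sum>k<N. f i k * X k j) = (if j = 0 then (if i = 0 then d else 0)
      else if j = Suc n then (if i = Suc n then d else 0) else f i j)"
    proof (cases "j = 0 \<or> j = Suc n")
      case True
      then show ?thesis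
        using AB[OF ij] by (auto simp: X_def)
    next
      case False
      then have "(\<Sum>k<N. f i k * X k j) = (\<Sum>k<N. if k = j then f i k else 0)"
        by (intro sum.cong) (auto simp: X_def)
      then show ?thesis
        using False ij by simp
    qed
  qed
  also have "\<dots> = d * (d * fdet n (\<lambda>i j. f (Suc i) (Suc j)))"
  proof -
    have "fdet N (\<lambda>i j. if j = 0 then (if i = 0 then d else 0)
        else if j = Suc n then (if i = Suc n then d else 0) else f i j)
      = d * fdet (Suc n) (\<lambda>i j. if j = n then (if i = n then d else 0) else f (Suc i) (Suc j))"
      unfolding N_def
      by (subst fdet_column_single[of 0 _ 0]) (auto intro!: disjI2 fdet_cong)
    also have "fdet (Suc n) (\<lambda>i j. if j = n then (if i = n then d else 0) else f (Suc i) (Suc j))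
      = d * fdet n (\<lambda>i j. f (Suc i) (Suc j))"
      by (subst fdet_column_single[of n _ n])
        (auto simp: insert_index_def intro!: disjI2 fdet_cong)
    finally show ?thesis .
  qed
  finally show ?thesis
    using nz by (simp add: d_def N_def)
qed

text \<open>Adding the variable to the diagonal entries makes the determinant a monic, hence
  nonzero, polynomial; the identity over polynomials is then evaluated at 0.\<close>

lemma fdet_dodgson:
  fixes f :: "nat \<Rightarrow> nat \<Rightarrow> 'a::idom"
  shows "fdet (Suc (Suc n)) f * fdet n (\<lambda>i j. f (Suc i) (Suc j)) =
    fdet (Suc n) f * fdet (Suc n) (\<lambda>i j. f (Suc i) (Suc j)) -
    fdet (Suc n) (\<lambda>i j. f (Suc i) j) * fdet (Suc n) (\<lambda>i j. f i (Suc j))"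
proof -
  define N where "N = Suc (Suc n)"
  define g where "g i j = [:f i j, if i = j then 1 else 0:]" for i j
  \<comment> \<open>The minus sign is there because \<open>char_poly A\<close> is the determinant of
    the variable times the identity minus \<open>A\<close>.\<close>
  define A where "A = mat N N (\<lambda>(i, j). - f i j)"
  have A: "A \<in> carrier_mat N N"
    by (simp add: A_def)
  have "char_poly A = fdet N g"
    unfolding char_poly_def fdet_def
    by (rule arg_cong[where f = det], rule eq_matI) (auto simp: char_poly_matrix_def A_def g_def)
  then have "fdet N g \<noteq> 0"
    using degree_monic_char_poly[OF A] by auto
  then have "fdet (Suc (Suc n)) g * fdet n (\<lambda>i j. g (Suc i) (Suc j)) =
    fdet (Suc n) g * fdet (Suc n) (\<lambda>i j. g (Suc i) (Suc j)) -
    fdet (Suc n) (\<lambda>i j. g (Suc i) j) * fdet (Suc n) (\<lambda>i j. g i (Suc j))" (is "?L = ?R")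
    unfolding N_def by (rule fdet_dodgson_nonzero)
  then have "poly ?L 0 = poly ?R 0"
    by simp
  then show ?thesis
    by (simp add: fdet_hom_poly g_def)
qed

section \<open>Restricted Cauchy matrices\<close>

text \<open>With \<open>rcauchy_sign\<close> as \<open>s\<close> this is the sign of the restricted
  Cauchy determinant: one factor -1 for every nonzero entry below the main diagonal. The rules that
  follow compare it for the minors in Dodgson's identity.\<close>

definition triangle_prod :: "nat \<Rightarrow> (nat \<Rightarrow> nat \<Rightarrow> 'a::comm_monoid_mult) \<Rightarrow> 'a" where
  "triangle_prod n s = (\<Prod>i<n. \<Prod>j<i. s i j)"

lemma triangle_prod_last: "triangle_prod (Suc n) s = triangle_prod n s * (\<Prod>j<n. s n j)"
  by (simp add: triangle_prod_def)

lemma triangle_prod_first: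
  "triangle_prod (Suc n) s = triangle_prod n (\<lambda>i j. s (Suc i) (Suc j)) * (\<Prod>i<n. s (Suc i) 0)"
  by (simp add: triangle_prod_def prod.lessThan_Suc_shift prod.distrib mult.commute del: prod.lessThan_Suc)

lemma triangle_prod_shift_rows:
  "triangle_prod (Suc n) s = triangle_prod n (\<lambda>i j. s (Suc i) j) * (\<Prod>i<n. s (Suc i) i)"
  unfolding triangle_prod_def prod.lessThan_Suc_shift[of _ n] by (simp add: prod.distrib)

text \<open>In row \<open>i\<close>, columns 1 to \<open>i\<close> and columns 0 to
  \<open>i - 1\<close> differ only at the ends. The end factors are multiplied in on both sides, as
  a monoid has no division.\<close>

lemma triangle_prod_shift_columns:
  "triangle_prod n (\<lambda>i j. s i (Suc j)) * (\<Prod>i<n. s i 0) = triangle_prod n s * (\<Prod>i<n. s i i)"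
proof -
  have "(\<Prod>j<i. s i (Suc j)) * s i 0 = (\<Prod>j<i. s i j) * s i i" for i
    using prod.lessThan_Suc_shift[of "s i" i] by (simp add: mult.commute)
  then show ?thesis
    by (simp add: triangle_prod_def flip: prod.distrib)
qed

definition rcauchy :: "(nat \<Rightarrow> 'a::linordered_field) \<Rightarrow> (nat \<Rightarrow> 'a) \<Rightarrow> nat \<Rightarrow> nat \<Rightarrow> 'a" where
  "rcauchy x y i j = (if y j < x i then 1 / (x i - y j) else 0)"

definition rcauchy_sign :: "(nat \<Rightarrow> 'a::linordered_field) \<Rightarrow> (nat \<Rightarrow> 'a) \<Rightarrow> nat \<Rightarrow> nat \<Rightarrow> 'a" where
  "rcauchy_sign x y i j = (if y j < x i then - 1 else 1)"

lemma rcauchy_sign_square: "rcauchy_sign x y i j * rcauchy_sign x y i j = 1"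
  by (simp add: rcauchy_sign_def)

text \<open>Eliminating with the upper left pivot leaves a Cauchy matrix with row \<open>i\<close>
  scaled by \<open>- r i\<close> and column \<open>j\<close> by \<open>c j\<close>, all
  \<open>r i\<close> and \<open>c j\<close> being positive. The minus signs cancel against the
  contribution of the first column to \<open>triangle_prod\<close>.\<close>

lemma cauchy_det_sign:
  fixes x y :: "nat \<Rightarrow> 'a::linordered_field"
  assumes "\<And>i j. i < j \<Longrightarrow> j < n \<Longrightarrow> x j < x i"
    and "\<And>i j. i < j \<Longrightarrow> j < n \<Longrightarrow> y j < y i"
    and "\<And>i j. i < n \<Longrightarrow> j < n \<Longrightarrow> y j < x i"
  shows "0 < triangle_prod n (rcauchy_sign x y) * fdet n (rcauchy x y)"
  using assms
proof (induction n arbitrary: x y)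
  case 0
  then show ?case by (simp add: triangle_prod_def)
next
  case (Suc n)
  let ?x = "\<lambda>i. x (Suc i)" and ?y = "\<lambda>j. y (Suc j)"
  define r where "r i = (x 0 - ?x i) / (?x i - y 0)" for i
  define c where "c j = (y 0 - ?y j) / (x 0 - ?y j)" for j
  have IH: "0 < triangle_prod n (rcauchy_sign ?x ?y) * fdet n (rcauchy ?x ?y)"
    by (rule Suc.IH) (use Suc.prems in auto)
  have f00: "rcauchy x y 0 0 > 0"
    using Suc.prems(3)[of 0 0] by (simp add: rcauchy_def)
  have "rcauchy x y (Suc i) (Suc j) - rcauchy x y (Suc i) 0 * rcauchy x y 0 (Suc j) / rcauchy x y 0 0
      = (- 1 * r i) * c j * rcauchy ?x ?y i j" if "i < n" "j < n" for i j
  proof -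
    have "y 0 < x 0" "y 0 < ?x i" "?y j < x 0" "?y j < ?x i"
      using Suc.prems(3) that by auto
    then show ?thesis
      by (simp add: rcauchy_def r_def c_def divide_simps) (simp add: algebra_simps)
  qed
  then have "fdet (Suc n) (rcauchy x y)
      = rcauchy x y 0 0 * ((\<Prod>i<n. - 1 * r i) * (\<Prod>j<n. c j) * fdet n (rcauchy ?x ?y))"
    using f00 by (simp add: fdet_pivot fdet_scale[symmetric] cong: fdet_cong)
  moreover have "triangle_prod (Suc n) (rcauchy_sign x y)
      = triangle_prod n (rcauchy_sign ?x ?y) * (\<Prod>i<n. - 1)"
    unfolding triangle_prod_first using Suc.prems(3) by (simp add: rcauchy_sign_def[abs_def])
  ultimately have "triangle_prod (Suc n) (rcauchy_sign x y) * fdet (Suc n) (rcauchy x y)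
      = rcauchy x y 0 0 * ((\<Prod>i<n. - 1) * (\<Prod>i<n. - 1 * r i)) * (\<Prod>j<n. c j)
          * (triangle_prod n (rcauchy_sign ?x ?y) * fdet n (rcauchy ?x ?y))"
    by (simp only: mult_ac)
  also have "(\<Prod>i<n. - 1) * (\<Prod>i<n. - 1 * r i) = (\<Prod>i<n. r i)"
    by (simp only: prod.distrib[symmetric]) simp
  finally have eq: "triangle_prod (Suc n) (rcauchy_sign x y) * fdet (Suc n) (rcauchy x y)
      = rcauchy x y 0 0 * (\<Prod>i<n. r i) * (\<Prod>j<n. c j)
          * (triangle_prod n (rcauchy_sign ?x ?y) * fdet n (rcauchy ?x ?y))" .
  have "(\<Prod>i<n. r i) > 0" "(\<Prod>j<n. c j) > 0"
    using Suc.prems by (auto simp: r_def c_def intro!: prod_pos divide_pos_pos)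
  with IH f00 show ?case
    unfolding eq by simp
qed

text \<open>Every minor in the Dodgson identity is again of this form or vanishes because of a zero block.
  When the lower left entry is zero, the signs given by the induction hypothesis make both terms
  on the right-hand side push in the same direction; when it is not, nothing is restricted.\<close>

theorem rcauchy_det_sign:
  fixes x y :: "nat \<Rightarrow> 'a::linordered_field"
  assumes "\<And>i j. i < j \<Longrightarrow> j < n \<Longrightarrow> x j < x i"
    and "\<And>i j. i < j \<Longrightarrow> j < n \<Longrightarrow> y j < y i"
    and "\<And>i. i < n \<Longrightarrow> y i < x i"
  shows "0 < triangle_prod n (rcauchy_sign x y) * fdet n (rcauchy x y)"
  using assms
proof (induction n arbitrary: x y rule: less_induct)
  case (less N)
  have mono: "x j \<le> x i" "y j \<le> y i" if "i \<le> j" "j < N" for i j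
    using less.prems(1,2) that by (metis le_less)+
  show ?case
  proof (cases "\<forall>i<N. \<forall>j<N. y j < x i")
    case True
    then show ?thesis
      using less.prems by (intro cauchy_det_sign) auto
  next
    case False
    then obtain a b where ab: "a < N" "b < N" "x a \<le> y b"
      by (auto simp: not_less)
    \<comment> \<open>Zeros spread downwards and to the left, hence reach the lower left
      corner.\<close>
    have corner: "x (N - 1) \<le> y 0"
      using mono(1)[of a "N - 1"] mono(2)[of 0 b] ab by force
    \<comment> \<open>In size 1 the corner would be the diagonal entry, which is nonzero.\<close>
    obtain n where N: "N = Suc (Suc n)"
    proof (cases N)
      case (Suc m)
      then show ?thesis
        using that corner less.prems(3)[of 0] by (cases m) auto
    qed (use ab in auto)
    let ?x = "\<lambda>i. x (Suc i)" and ?y = "\<lambda>j. y (Suc j)"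
    let ?s = "rcauchy_sign x y"
    define P where "P = triangle_prod N ?s"
    \<comment> \<open>Suffixes: 0 is the interior minor, 1 the upper left, 2 the lower right, 3 the
      lower left and 4 the upper right one.\<close>
    define P0 P1 P2 P3 P4
      where "P0 = triangle_prod n (rcauchy_sign ?x ?y)"
        and "P1 = triangle_prod (Suc n) (rcauchy_sign x y)"
        and "P2 = triangle_prod (Suc n) (rcauchy_sign ?x ?y)"
        and "P3 = triangle_prod (Suc n) (rcauchy_sign ?x y)"
        and "P4 = triangle_prod (Suc n) (rcauchy_sign x ?y)"
    define D where "D = fdet N (rcauchy x y)"
    define D0 D1 D2 D3 D4
      where "D0 = fdet n (rcauchy ?x ?y)"
        and "D1 = fdet (Suc n) (rcauchy x y)"
        and "D2 = fdet (Suc n) (rcauchy ?x ?y)"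
        and "D3 = fdet (Suc n) (rcauchy ?x y)"
        and "D4 = fdet (Suc n) (rcauchy x ?y)"
    have D0: "0 < P0 * D0"
      unfolding P0_def D0_def by (rule less.IH) (use less.prems N in auto)
    have D1: "0 < P1 * D1"
      unfolding P1_def D1_def by (rule less.IH) (use less.prems N in auto)
    have D2: "0 < P2 * D2"
      unfolding P2_def D2_def by (rule less.IH) (use less.prems N in auto)
    \<comment> \<open>Moving on to the next, smaller \<open>y\<close> keeps the diagonal nonzero, so
      the upper right minor always falls under the induction hypothesis; the lower left one need
      not.\<close>
    have D4: "0 < P4 * D4"
      unfolding P4_def D4_def
    proof (rule less.IH)
      show "y (Suc i) < x i" if "i < Suc n" for i
        using less.prems(2)[of i "Suc i"] less.prems(3)[of i] that N by auto
    qed (use less.prems N in auto)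
    have shift: "rcauchy_sign ?x ?y = (\<lambda>i j. ?s (Suc i) (Suc j))"
      "rcauchy_sign ?x y = (\<lambda>i j. ?s (Suc i) j)"
      "rcauchy_sign x ?y = (\<lambda>i j. ?s i (Suc j))"
      "rcauchy ?x ?y = (\<lambda>i j. rcauchy x y (Suc i) (Suc j))"
      "rcauchy ?x y = (\<lambda>i j. rcauchy x y (Suc i) j)"
      "rcauchy x ?y = (\<lambda>i j. rcauchy x y i (Suc j))"
      by (simp_all add: rcauchy_sign_def rcauchy_def fun_eq_iff)
    have dodgson: "D * D0 = D1 * D2 - D3 * D4"
      unfolding D_def D0_def D1_def D2_def D3_def D4_def shift N by (rule fdet_dodgson)
    have square: "triangle_prod m (rcauchy_sign u v) * triangle_prod m (rcauchy_sign u v) = 1"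
      for m and u v :: "nat \<Rightarrow> 'a"
      by (simp add: triangle_prod_def rcauchy_sign_square flip: prod.distrib)
    define \<alpha> where "\<alpha> = (\<Prod>i<n. ?s (Suc i) 0)"
    define \<beta> where "\<beta> = (\<Prod>j<n. ?s (Suc n) (Suc j))"
    \<comment> \<open>The vanishing corner contributes 1; this fixes the sign \<open>P\<close>
      relative to \<open>P2\<close>.\<close>
    have s_corner: "?s (Suc n) 0 = 1"
      using corner N by (simp add: rcauchy_sign_def)
    have s_diag: "?s i i = - 1" if "i < N" for i
      using less.prems(3)[OF that] by (simp add: rcauchy_sign_def)
    have P1: "P1 = \<alpha> * P0"
      unfolding P1_def P0_def \<alpha>_def shift triangle_prod_first by simp
    have P2: "P2 = \<beta> * P0"
      unfolding P2_def P0_def \<beta>_def shift triangle_prod_last by simp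
    have P: "P = \<alpha> * P2"
      unfolding P_def P2_def \<alpha>_def shift N triangle_prod_first by (simp add: s_corner)
    have sq: "\<alpha> * \<alpha> = 1" "P0 * P0 = 1"
      using square by (auto simp: \<alpha>_def P0_def rcauchy_sign_square simp flip: prod.distrib)
    have PP: "P * P0 = P1 * P2"
      using sq by (simp add: P P1 P2 mult_ac)
    have "P4 * (- \<alpha>) = P1 * (- 1) ^ Suc n"
    proof -
      have "(\<Prod>i<Suc n. ?s i 0) = - \<alpha>"
        unfolding prod.lessThan_Suc_shift by (simp add: \<alpha>_def s_diag N)
      moreover have "(\<Prod>i<Suc n. ?s i i) = (- 1) ^ Suc n"
        by (simp add: s_diag N)
      ultimately show ?thesis
        using triangle_prod_shift_columns[of "Suc n" ?s] by (simp only: P4_def P1_def shift)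
    qed
    then have "\<alpha> * \<alpha> * P4 = \<alpha> * \<alpha> * (P0 * (- 1) ^ n)"
      by (simp add: P1 mult_ac)
    then have P4: "P4 = P0 * (- 1) ^ n"
      by (simp add: sq)
    \<comment> \<open>Either the induction hypothesis applies to the lower left minor, and its sign
      makes the subtracted product nonpositive after multiplication by \<open>P * P0\<close>, or a
      diagonal entry of it vanishes, and with it a block large enough to make the minor 0.\<close>
    have "0 \<le> - (P * P0) * (D3 * D4)"
    proof (cases "\<forall>i<Suc n. y i < ?x i")
      case True
      have D3: "0 < P3 * D3"
        unfolding P3_def D3_def by (rule less.IH) (use less.prems N True in auto)
      have "P = P3 * (- 1) ^ Suc n"
        unfolding P_def P3_def shift N triangle_prod_shift_rows
        using True by (simp add: rcauchy_sign_def)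
      then have "- (P * P0) = P3 * P4"
        by (simp add: P4 mult_ac)
      then have "- (P * P0) * (D3 * D4) = (P3 * D3) * (P4 * D4)"
        by (simp add: mult_ac)
      with D3 D4 show ?thesis
        by simp
    next
      case False
      then obtain k where k: "k < Suc n" "x (Suc k) \<le> y k"
        by (auto simp: not_less)
      have "D3 = 0"
        unfolding D3_def
      proof (rule fdet_zero_block[of k])
        fix i j
        assume "k \<le> i" "i < Suc n" "j \<le> k"
        then show "rcauchy ?x y i j = 0"
          using mono(1)[of "Suc k" "Suc i"] mono(2)[of j k] k N by (simp add: rcauchy_def)
      qed (use k in auto)
      then show ?thesis
        by simp
    qed
    moreover have "(P * D) * (P0 * D0) = (P1 * D1) * (P2 * D2) + - (P * P0) * (D3 * D4)"
    proof -
      have "(P * D) * (P0 * D0) = (P * P0) * (D1 * D2) - (P * P0) * (D3 * D4)"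
        using arg_cong[OF dodgson, of "(*) (P * P0)"] by (simp add: algebra_simps)
      moreover have "(P * P0) * (D1 * D2) = (P1 * D1) * (P2 * D2)"
        unfolding PP by (simp add: mult_ac)
      ultimately show ?thesis
        by simp
    qed
    moreover have "0 < (P1 * D1) * (P2 * D2)"
      using D1 D2 by simp
    ultimately have "0 < (P * D) * (P0 * D0)"
      by linarith
    then show ?thesis
      unfolding P_def D_def using D0 by (rule zero_less_mult_pos2)
  qed
qed

text \<open>What remains of the Jacobi-Trudi matrix at \<open>t = 0\<close> once the rows without an
  entry 1 are divided by \<open>t\<close>. A matched row is a unit vector when the
  \<open>y j\<close> are distinct.\<close>

definition matched_rcauchy ::
    "nat \<Rightarrow> (nat \<Rightarrow> 'a::linordered_field) \<Rightarrow> (nat \<Rightarrow> 'a) \<Rightarrow> nat \<Rightarrow> nat \<Rightarrow> 'a" where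
  "matched_rcauchy n x y i j =
     (if x i \<in> y ` {..<n} then (if x i = y j then 1 else 0) else rcauchy x y i j)"

lemma strict_decreasing_insert_index:
  fixes x :: "nat \<Rightarrow> 'a::order"
  assumes "\<And>i j. i < j \<Longrightarrow> j < Suc n \<Longrightarrow> x j < x i" "i < j" "j < n"
  shows "x (insert_index k j) < x (insert_index k i)"
  using assms by (auto simp: insert_index_def)

text \<open>A row whose point occurs among the \<open>y j\<close> is a unit vector; expanding along it removes the
  point from both sequences without disturbing the hypotheses.\<close>

lemma matched_rcauchy_det_nonzero:
  fixes x y :: "nat \<Rightarrow> 'a::linordered_field"
  assumes "\<And>i j. i < j \<Longrightarrow> j < n \<Longrightarrow> x j < x i"
    and "\<And>i j. i < j \<Longrightarrow> j < n \<Longrightarrow> y j < y i"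
    and "\<And>i. i < n \<Longrightarrow> y i \<le> x i"
  shows "fdet n (matched_rcauchy n x y) \<noteq> 0"
  using assms
proof (induction n arbitrary: x y)
  case (Suc n)
  have less_x: "x j < x i \<longleftrightarrow> i < j" if "i < Suc n" "j < Suc n" for i j
    using Suc.prems(1) that by (metis less_asym linorder_neqE_nat)
  have less_y: "y j < y i \<longleftrightarrow> i < j" if "i < Suc n" "j < Suc n" for i j
    using Suc.prems(2) that by (metis less_asym linorder_neqE_nat)
  show ?case
  proof (cases "\<exists>i<Suc n. x i \<in> y ` {..<Suc n}")
    case False
    then have "fdet (Suc n) (matched_rcauchy (Suc n) x y) = fdet (Suc n) (rcauchy x y)"
      by (intro fdet_cong) (auto simp: matched_rcauchy_def)
    moreover have "0 < triangle_prod (Suc n) (rcauchy_sign x y) * fdet (Suc n) (rcauchy x y)"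
    proof (rule rcauchy_det_sign)
      show "y i < x i" if "i < Suc n" for i
        using Suc.prems(3)[OF that] False that by (metis image_eqI lessThan_iff order_le_less)
    qed (use Suc.prems in auto)
    ultimately show ?thesis
      by auto
  next
    case True
    then obtain k l where kl: "k < Suc n" "l < Suc n" "x k = y l"
      by auto
    \<comment> \<open>Otherwise \<open>x l < x k = y l\<close>, against
      \<open>y l \<le> x l\<close>.\<close>
    have "l \<le> k"
      using Suc.prems(3)[of l] kl less_x[of l k] by (metis less_x linorder_not_less)
    define x' where "x' i = x (insert_index k i)" for i
    define y' where "y' j = y (insert_index l j)" for j
    have skip: "insert_index k i < Suc n" "insert_index l i < Suc n" if "i < n" for i
      using that by (auto simp: insert_index_def)
    have "y j = x k \<longleftrightarrow> j = l" if "j < Suc n" for j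
      using kl less_y[OF that kl(2)] less_y[OF kl(2) that] by (metis less_irrefl linorder_neqE_nat)
    moreover have "x k \<in> y ` {..<Suc n}"
      using kl by blast
    ultimately have unit: "matched_rcauchy (Suc n) x y k j = (if j = l then 1 else 0)"
      if "j < Suc n" for j
      using that unfolding matched_rcauchy_def by metis
    have "fdet (Suc n) (matched_rcauchy (Suc n) x y)
      = (- 1) ^ (k + l) * fdet n (\<lambda>i j. matched_rcauchy (Suc n) x y (insert_index k i) (insert_index l j))"
      using kl(1,2) by (subst fdet_row_single[of k _ l]) (simp_all add: unit)
    also have "fdet n (\<lambda>i j. matched_rcauchy (Suc n) x y (insert_index k i) (insert_index l j))
      = fdet n (matched_rcauchy n x' y')"
    proof (rule fdet_cong)
      fix i j
      assume ij: "i < n" "j < n"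
      have "insert_index k i \<noteq> k"
        by simp
      then have "x' i \<noteq> y l"
        using less_x[OF kl(1) skip(1)[OF ij(1)]] less_x[OF skip(1)[OF ij(1)] kl(1)] kl(3)
        unfolding x'_def by (metis less_irrefl linorder_neqE_nat)
      moreover have "{..<Suc n} = insert l (insert_index l ` {..<n})"
        using insert_index_image[OF kl(2)] kl(2) by (auto simp: atLeast0LessThan)
      ultimately have "x' i \<in> y ` {..<Suc n} \<longleftrightarrow> x' i \<in> y' ` {..<n}"
        unfolding y'_def by auto
      then show "matched_rcauchy (Suc n) x y (insert_index k i) (insert_index l j) = matched_rcauchy n x' y' i j"
        by (simp add: matched_rcauchy_def rcauchy_def x'_def y'_def)
    qed
    also have "fdet n (matched_rcauchy n x' y') \<noteq> 0"
    proof (rule Suc.IH)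
      show "x' j < x' i" if "i < j" "j < n" for i j
        unfolding x'_def by (rule strict_decreasing_insert_index) (use Suc.prems that in auto)
      show "y' j < y' i" if "i < j" "j < n" for i j
        unfolding y'_def by (rule strict_decreasing_insert_index) (use Suc.prems that in auto)
      \<comment> \<open>For indices from \<open>l\<close> to \<open>k - 1\<close> only
        \<open>y\<close> is shifted, which lowers it; \<open>l \<le> k\<close> excludes a shift of
        \<open>x\<close> alone.\<close>
      show "y' i \<le> x' i" if "i < n" for i
        using Suc.prems(3)[of i] Suc.prems(3)[of "Suc i"] Suc.prems(2)[of i "Suc i"] that \<open>l \<le> k\<close>
        by (auto simp: x'_def y'_def insert_index_def)
    qed
    ultimately show ?thesis
      by simp
  qed
qed simp

section \<open>Tableaux and the Jacobi-Trudi identity\<close>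

text \<open>Row ends are sequences indexed from 0 while squares count from 1, so row
  \<open>i\<close> belongs to index \<open>i - 1\<close>. Sequences instead of lists allow the outer
  boundary to be chosen row by row.\<close>

definition shape :: "nat \<Rightarrow> (nat \<Rightarrow> nat) \<Rightarrow> (nat \<Rightarrow> nat) \<Rightarrow> (nat \<times> nat) set" where
  "shape n a b = {(i, j). 1 \<le> i \<and> i \<le> n \<and> b (i - 1) < j \<and> j \<le> a (i - 1)}"

lemma Suc_in_shape: "(Suc i, j) \<in> shape n a b \<longleftrightarrow> i < n \<and> b i < j \<and> j \<le> a i"
  by (auto simp: shape_def)

lemma shapeE:
  assumes "(i, j) \<in> shape n a b"
  obtains k where "i = Suc k" "k < n" "b k < j" "j \<le> a k"
  using assms by (cases i) (auto simp: shape_def)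

lemma shape_cong:
  assumes "\<And>i. i < n \<Longrightarrow> a i = a' i"
  shows "shape n a b = shape n a' b"
  using assms by (auto simp: shape_def)

lemma finite_shape: "finite (shape n a b)"
proof -
  have "shape n a b \<subseteq> (\<Union>i<n. {Suc i} \<times> {..a i})"
    by (auto elim!: shapeE)
  then show ?thesis
    by (rule finite_subset) auto
qed

definition tableaux :: "nat \<Rightarrow> (nat \<times> nat) set \<Rightarrow> (nat \<times> nat \<Rightarrow> nat) set" where
  "tableaux t D = {T \<in> ssyt D. \<forall>s\<in>D. T s \<le> t}"

lemma tableauxI:
  assumes "\<And>s. s \<in> D \<Longrightarrow> 1 \<le> T s" "\<And>s. s \<in> D \<Longrightarrow> T s \<le> t" "\<And>s. s \<notin> D \<Longrightarrow> T s = 0"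
    and "\<And>i j j'. (i, j) \<in> D \<Longrightarrow> (i, j') \<in> D \<Longrightarrow> j < j' \<Longrightarrow> T (i, j) \<le> T (i, j')"
    and "\<And>i i' j. (i, j) \<in> D \<Longrightarrow> (i', j) \<in> D \<Longrightarrow> i < i' \<Longrightarrow> T (i, j) < T (i', j)"
  shows "T \<in> tableaux t D"
  using assms unfolding tableaux_def ssyt_def by blast

lemma tableauxD:
  assumes "T \<in> tableaux t D"
  shows "s \<in> D \<Longrightarrow> 1 \<le> T s" "s \<in> D \<Longrightarrow> T s \<le> t" "s \<notin> D \<Longrightarrow> T s = 0"
    and "(i, j) \<in> D \<Longrightarrow> (i, j') \<in> D \<Longrightarrow> j < j' \<Longrightarrow> T (i, j) \<le> T (i, j')"
    and "(i, j) \<in> D \<Longrightarrow> (i', j) \<in> D \<Longrightarrow> i < i' \<Longrightarrow> T (i, j) < T (i', j)"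
  using assms unfolding tableaux_def ssyt_def by blast+

lemma finite_tableaux:
  assumes "finite D"
  shows "finite (tableaux t D)"
proof (rule finite_subset)
  show "tableaux t D \<subseteq> {T. \<forall>s. (s \<in> D \<longrightarrow> T s \<in> {..t}) \<and> (s \<notin> D \<longrightarrow> T s = 0)}"
    by (auto dest: tableauxD)
qed (intro finite_set_of_finite_funs assms finite_atMost)

section \<open>Horizontal strips and the branching of tableaux\<close>

definition strips :: "nat \<Rightarrow> (nat \<Rightarrow> nat) \<Rightarrow> (nat \<Rightarrow> nat) set" where
  "strips n a = Pi\<^sub>E {..<n} (\<lambda>i. {a (Suc i)..a i})"

lemma stripsD:
  assumes "c \<in> strips n a" "i < n"
  shows "a (Suc i) \<le> c i" "c i \<le> a i"
  using assms by (auto simp: strips_def dest!: PiE_mem)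

lemma finite_strips: "finite (strips n a)"
  unfolding strips_def by (intro finite_PiE) auto

definition add_strip :: "(nat \<times> nat) set \<Rightarrow> nat \<Rightarrow> (nat \<times> nat \<Rightarrow> nat) \<Rightarrow> nat \<times> nat \<Rightarrow> nat" where
  "add_strip E m T s = (if s \<in> E then m else T s)"

text \<open>The condition \<open>a (Suc i) \<le> c i \<le> a i\<close> says that the squares between
  \<open>c\<close> and \<open>a\<close> form a horizontal strip, with at most one square per column;
  so they can all carry the new largest entry.\<close>

lemma add_strip_tableaux:
  assumes a: "decseq a" and c: "c \<in> strips n a" "\<And>i. i < n \<Longrightarrow> b i \<le> c i"
    and T: "T \<in> tableaux t (shape n c b)"
  shows "add_strip (shape n a c) (Suc t) T \<in> tableaux (Suc t) (shape n a b)"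
proof -
  have split: "s \<in> shape n a b \<longleftrightarrow> s \<in> shape n c b \<or> s \<in> shape n a c" for s
  proof (cases s)
    case (Pair i j)
    show ?thesis
    proof (cases "\<exists>k<n. i = Suc k")
      case True
      then obtain k where "k < n" "i = Suc k"
        by blast
      with Pair c(2)[of k] stripsD[OF c(1), of k] show ?thesis
        by (auto simp: Suc_in_shape)
    qed (auto simp: Pair elim: shapeE)
  qed
  have disj: "s \<notin> shape n a c" if "s \<in> shape n c b" for s
    using that by (auto simp: shape_def)
  have low: "add_strip (shape n a c) (Suc t) T s = T s" if "s \<in> shape n c b" for s
    using disj[OF that] by (simp add: add_strip_def)
  have high: "add_strip (shape n a c) (Suc t) T s = Suc t" if "s \<in> shape n a c" for s
    using that by (simp add: add_strip_def)
  note T = tableauxD[OF T]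
  show ?thesis
  proof (rule tableauxI)
    fix i j j'
    assume *: "(i, j) \<in> shape n a b" "(i, j') \<in> shape n a b" "j < j'"
    have "(i, j') \<notin> shape n c b" if "(i, j) \<in> shape n a c"
      using that \<open>j < j'\<close> by (auto simp: shape_def)
    with * show "add_strip (shape n a c) (Suc t) T (i, j) \<le> add_strip (shape n a c) (Suc t) T (i, j')"
      using T(2) T(4)[of i j j'] by (auto simp: split low high le_Suc_eq)
  next
    fix i i' j
    assume *: "(i, j) \<in> shape n a b" "(i', j) \<in> shape n a b" "i < i'"
    \<comment> \<open>The upper of two squares in a column is outside the strip: the lower one lies
      in a column up to \<open>a (Suc k)\<close>, which is at most \<open>c k\<close>.\<close>
    have "(i, j) \<notin> shape n a c"
    proof
      assume "(i, j) \<in> shape n a c"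
      then obtain k where k: "i = Suc k" "k < n" "c k < j"
        by (auto elim: shapeE)
      obtain k' where k': "i' = Suc k'" "j \<le> a k'"
        using *(2) by (auto elim: shapeE)
      have "a k' \<le> a (Suc k)"
        using decseqD[OF a, of "Suc k" k'] * k k' by auto
      then show False
        using stripsD(1)[OF c(1) k(2)] k k' by simp
    qed
    then have "(i, j) \<in> shape n c b"
      using * split by blast
    with * show "add_strip (shape n a c) (Suc t) T (i, j) < add_strip (shape n a c) (Suc t) T (i', j)"
      using T(2)[of "(i, j)"] T(5)[of i j i'] by (auto simp: split low high)
  qed (use T in \<open>auto simp: split low high le_Suc_eq add_strip_def\<close>)
qed

text \<open>The entries at most \<open>t\<close> fill an initial segment of each row, ending at
  \<open>c i\<close>; strictness down the columns forces what remains to be a horizontal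
  strip.\<close>

lemma add_strip_surj:
  assumes a: "decseq a" "a n = 0" and b: "decseq b" "\<And>i. i < n \<Longrightarrow> b i \<le> a i"
    and T: "T \<in> tableaux (Suc t) (shape n a b)"
  obtains c T' where "c \<in> strips n a" "\<And>i. i < n \<Longrightarrow> b i \<le> c i"
    "T' \<in> tableaux t (shape n c b)" "T = add_strip (shape n a c) (Suc t) T'"
proof -
  note T = tableauxD[OF T]
  \<comment> \<open>Including \<open>b i\<close> keeps the set nonempty and makes
    \<open>c i = b i\<close> when the row has no entry up to \<open>t\<close>.\<close>
  define C where "C i = {j. j = b i \<or> b i < j \<and> j \<le> a i \<and> T (Suc i, j) \<le> t}" for i
  define c where "c = (\<lambda>i\<in>{..<n}. Max (C i))"
  have fin: "finite (C i)" "C i \<noteq> {}" for i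
    by (auto simp: C_def intro: finite_subset[of _ "{..max (a i) (b i)}"])
  have cC: "c i \<in> C i" if "i < n" for i
    using Max_in[OF fin[of i]] that by (simp add: c_def)
  have c_max: "j \<le> c i" if "i < n" "j \<in> C i" for i j
    using Max_ge[OF fin(1) that(2)] that by (simp add: c_def)
  have bc: "b i \<le> c i" if "i < n" for i
    using cC[OF that] by (auto simp: C_def)
  have ca: "c i \<le> a i" if "i < n" for i
    using cC[OF that] b(2)[OF that] by (auto simp: C_def)
  have le_t: "T (Suc i, j) \<le> t \<longleftrightarrow> j \<le> c i" if "(Suc i, j) \<in> shape n a b" for i j
  proof
    assume "T (Suc i, j) \<le> t"
    then show "j \<le> c i"
      using that by (intro c_max) (auto simp: C_def Suc_in_shape)
  next
    assume "j \<le> c i"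
    then have "(Suc i, c i) \<in> shape n a b" "T (Suc i, c i) \<le> t"
      using that cC[of i] by (auto simp: C_def Suc_in_shape)
    then show "T (Suc i, j) \<le> t"
      using T(4)[OF that, of "c i"] \<open>j \<le> c i\<close> by (cases "j = c i") auto
  qed
  \<comment> \<open>Otherwise the entry \<open>Suc t\<close> at column \<open>a (Suc i)\<close>
    would have a larger one below it. For the last row \<open>a n = 0\<close> makes the bound
    trivial.\<close>
  have "a (Suc i) \<le> c i" if "i < n" for i
  proof (rule ccontr)
    assume less: "\<not> a (Suc i) \<le> c i"
    then have "Suc i < n"
      using a that decseqD[OF a(1), of n "Suc i"] by (cases "Suc i = n") auto
    then have "(Suc i, a (Suc i)) \<in> shape n a b" "(Suc (Suc i), a (Suc i)) \<in> shape n a b"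
      using less bc[OF that] decseqD[OF a(1), of i "Suc i"] decseqD[OF b(1), of i "Suc i"]
      by (auto simp: Suc_in_shape)
    then show False
      using T(5)[of "Suc i" "a (Suc i)" "Suc (Suc i)"] T(2)[of "(Suc (Suc i), a (Suc i))"]
        le_t[of i "a (Suc i)"] less by auto
  qed
  then have c: "c \<in> strips n a"
    using ca by (auto simp: strips_def c_def)
  define T' where "T' s = (if s \<in> shape n c b then T s else 0)" for s
  have sub: "s \<in> shape n a b" if "s \<in> shape n c b" for s
    using that ca by (cases s) (fastforce elim!: shapeE simp: Suc_in_shape)
  have "T' \<in> tableaux t (shape n c b)"
  proof (rule tableauxI)
    show "T' s \<le> t" if "s \<in> shape n c b" for s
    proof (cases s)
      case (Pair i j)
      with that sub[OF that] le_t show ?thesis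
        by (auto elim!: shapeE simp: T'_def Suc_in_shape)
    qed
  qed (use T sub in \<open>auto simp: T'_def\<close>)
  moreover have "T = add_strip (shape n a c) (Suc t) T'"
  proof
    fix s
    show "T s = add_strip (shape n a c) (Suc t) T' s"
    proof (cases "s \<in> shape n a b")
      case True
      obtain i j where s: "s = (Suc i, j)" "i < n" "b i < j" "j \<le> a i"
        using True by (cases s) (auto elim: shapeE)
      then show ?thesis
        using T(2)[OF True] le_t[of i j] True
        by (auto simp: add_strip_def T'_def Suc_in_shape not_le)
    next
      case False
      then have "s \<notin> shape n c b" "s \<notin> shape n a c"
        using sub bc by (auto simp: shape_def) (metis One_nat_def Suc_pred less_le_trans not_less not_less_eq_eq)
      with False show ?thesis
        using T(3) by (simp add: add_strip_def T'_def)
    qed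
  qed
  ultimately show ?thesis
    using that c bc by blast
qed

lemma card_tableaux_Suc:
  assumes a: "decseq a" "a n = 0" and b: "decseq b" "\<And>i. i < n \<Longrightarrow> b i \<le> a i"
  shows "card (tableaux (Suc t) (shape n a b)) =
    (\<Sum>c | c \<in> strips n a \<and> (\<forall>i<n. b i \<le> c i). card (tableaux t (shape n c b)))"
proof -
  define S where "S = {c \<in> strips n a. \<forall>i<n. b i \<le> c i}"
  let ?P = "SIGMA c:S. tableaux t (shape n c b)"
  let ?f = "\<lambda>(c, T). add_strip (shape n a c) (Suc t) T"
  have "bij_betw ?f ?P (tableaux (Suc t) (shape n a b))"
  proof (rule bij_betw_imageI)
    show "inj_on ?f ?P"
    proof (rule inj_onI, clarify)
      fix c T c' T'
      assume c: "c \<in> S" "c' \<in> S"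
        and T: "T \<in> tableaux t (shape n c b)" "T' \<in> tableaux t (shape n c' b)"
        and eq: "add_strip (shape n a c) (Suc t) T = add_strip (shape n a c') (Suc t) T'"
      \<comment> \<open>Entries of \<open>T\<close> stay below \<open>Suc t\<close>, so the strip is
        recovered as the set of squares with that value.\<close>
      have mem: "s \<in> shape n a c \<longleftrightarrow> add_strip (shape n a c) (Suc t) T s = Suc t"
        if "T \<in> tableaux t (shape n c b)" for c s T
        using tableauxD(2,3)[OF that, of s] by (cases "s \<in> shape n c b") (auto simp: add_strip_def)
      have shape_eq: "shape n a c = shape n a c'"
        using mem[OF T(1)] mem[OF T(2)] eq by auto
      have "c i = c' i" if "i < n" for i
      proof -
        have "c i < j \<and> j \<le> a i \<longleftrightarrow> c' i < j \<and> j \<le> a i" for j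
          using shape_eq that by (metis Suc_in_shape)
        from this[of "Suc (c i)"] this[of "Suc (c' i)"] this[of "c i"] this[of "c' i"] show ?thesis
          using c that by (fastforce simp: S_def dest: stripsD)
      qed
      \<comment> \<open>Members of \<open>strips\<close> are extensional, so agreement below
        \<open>n\<close> suffices.\<close>
      then have "c = c'"
        using c unfolding S_def strips_def by (auto intro: PiE_ext)
      moreover have "T s = T' s" for s
        using fun_cong[OF eq, of s] tableauxD(3)[OF T(1), of s] tableauxD(3)[OF T(2), of s] \<open>c = c'\<close>
        by (auto simp: add_strip_def shape_def split: if_splits)
      ultimately show "c = c' \<and> T = T'"
        by auto
    qed
    show "?f ` ?P = tableaux (Suc t) (shape n a b)"
    proof (intro equalityI subsetI)
      fix T
      assume "T \<in> ?f ` ?P"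
      then show "T \<in> tableaux (Suc t) (shape n a b)"
        using add_strip_tableaux[OF a(1)] by (auto simp: S_def)
    next
      fix T
      assume "T \<in> tableaux (Suc t) (shape n a b)"
      then obtain c T' where "c \<in> strips n a" "\<And>i. i < n \<Longrightarrow> b i \<le> c i"
        "T' \<in> tableaux t (shape n c b)" "T = add_strip (shape n a c) (Suc t) T'"
        using add_strip_surj[OF a b] by metis
      then show "T \<in> ?f ` ?P"
        by (auto simp: S_def intro!: image_eqI[of _ _ "(c, T')"])
    qed
  qed
  then have "card (tableaux (Suc t) (shape n a b)) = card ?P"
    by (rule bij_betw_same_card[symmetric])
  also have "\<dots> = (\<Sum>c\<in>S. card (tableaux t (shape n c b)))"
    by (rule card_SigmaI) (auto simp: S_def finite_strips finite_tableaux finite_shape)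
  finally show ?thesis
    by (simp add: S_def)
qed

section \<open>The numbers h_k(1^t) and the Jacobi-Trudi determinant\<close>

definition hnum :: "nat \<Rightarrow> int \<Rightarrow> rat" where
  "hnum t k = (if k < 0 then 0 else pochhammer (of_nat t) (nat k) / fact (nat k))"

text \<open>\<open>hnum t k\<close> counts the monomials of degree \<open>k\<close> in
  \<open>t\<close> variables; among those in one more variable, the ones not divisible by the new
  variable are the old ones.\<close>

lemma hnum_Suc: "hnum (Suc t) k - hnum (Suc t) (k - 1) = hnum t k"
proof (cases "k \<le> 0")
  case False
  then obtain m where k: "k = int (Suc m)"
    by (metis not_le pos_int_cases Suc_pred)
  have "pochhammer (of_nat t :: rat) (Suc m) = of_nat t * pochhammer (of_nat (Suc t)) m"
    by (simp add: pochhammer_rec add.commute)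
  moreover have "pochhammer (of_nat (Suc t) :: rat) (Suc m)
      = pochhammer (of_nat (Suc t)) m * (of_nat (Suc t) + of_nat m)"
    by (rule pochhammer_Suc)
  ultimately show ?thesis
    unfolding k hnum_def by (simp add: field_simps del: of_nat_Suc) (simp add: algebra_simps)
qed (auto simp: hnum_def)

lemma sum_hnum:
  assumes "p \<le> q"
  shows "(\<Sum>c = p..q. hnum t (int c - d)) = hnum (Suc t) (int q - d) - hnum (Suc t) (int p - 1 - d)"
  using assms
proof (induction rule: dec_induct)
  case base
  then show ?case
    using hnum_Suc[of t "int p - d"] by (simp add: algebra_simps)
next
  case (step m)
  then show ?case
    using hnum_Suc[of t "int (Suc m) - d"] by (simp add: algebra_simps)
qed

definition jacobi_trudi :: "nat \<Rightarrow> (nat \<Rightarrow> nat) \<Rightarrow> (nat \<Rightarrow> nat) \<Rightarrow> nat \<Rightarrow> nat \<Rightarrow> rat" where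
  "jacobi_trudi t a b i j = hnum t ((int (a i) - int i) - (int (b j) - int j))"

text \<open>Multilinearity in the rows: a choice of one summand from every row is a function in
  \<open>Pi\<^sub>E\<close>.\<close>

lemma fdet_sum_rows:
  assumes "\<And>i. i < n \<Longrightarrow> finite (S i)"
  shows "fdet n (\<lambda>i j. \<Sum>c\<in>S i. g i c j) = (\<Sum>c\<in>Pi\<^sub>E {..<n} S. fdet n (\<lambda>i j. g i (c i) j))"
proof -
  have "(\<Prod>i<n. \<Sum>c\<in>S i. g i c (p i)) = (\<Sum>c\<in>Pi\<^sub>E {..<n} S. \<Prod>i<n. g i (c i) (p i))" for p
    by (rule prod_sum_PiE) (use assms in auto)
  then show ?thesis
    unfolding fdet_leibniz by (subst sum.swap) (simp add: sum_distrib_left)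
qed

text \<open>Subtracting the next row from each row is a unitriangular operation; for the last row
  the next one is the fictitious row \<open>n\<close>, which is zero.\<close>

lemma fdet_row_differences:
  assumes "\<And>j. j < n \<Longrightarrow> f n j = 0"
  shows "fdet n f = fdet n (\<lambda>i j. f i j - f (Suc i) j)"
proof -
  define U where "U i k = (if i \<le> k then 1 else 0 :: 'a)" for i k :: nat
  have "fdet n f = fdet n (\<lambda>i j. \<Sum>k<n. U i k * (f k j - f (Suc k) j))"
  proof (rule fdet_cong)
    fix i j
    assume "i < n" "j < n"
    have "(\<Sum>k<n. U i k * (f k j - f (Suc k) j)) = (\<Sum>k = i..<n. f k j - f (Suc k) j)"
      by (rule sum.mono_neutral_cong_right) (auto simp: U_def)
    also have "\<dots> = - (\<Sum>k = i..<n. f (Suc k) j - f k j)"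
      by (simp add: sum_subtractf)
    also have "\<dots> = f i j"
      using \<open>i < n\<close> assms[OF \<open>j < n\<close>] sum_Suc_diff'[of i n "\<lambda>k. f k j"] by simp
    finally show "f i j = (\<Sum>k<n. U i k * (f k j - f (Suc k) j))" ..
  qed
  also have "\<dots> = fdet n U * fdet n (\<lambda>i j. f i j - f (Suc i) j)"
    by (rule fdet_mult[symmetric])
  also have "fdet n U = 1"
    by (subst fdet_upper_triangular) (auto simp: U_def)
  finally show ?thesis
    by simp
qed

text \<open>The determinant obeys the branching recursion of the tableaux: each row difference is a
  sum over \<open>c i\<close> between \<open>a (Suc i)\<close> and \<open>a i\<close>, and
  multilinearity pulls these sums out.\<close>

lemma fdet_jacobi_trudi_Suc:
  assumes "decseq a" "a n = 0"
  shows "fdet n (jacobi_trudi (Suc t) a b) = (\<Sum>c\<in>strips n a. fdet n (jacobi_trudi t c b))"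
proof -
  \<comment> \<open>Row \<open>n\<close> vanishes because \<open>a n = 0\<close> makes the index
    \<open>j - n - b j\<close> negative.\<close>
  have "fdet n (jacobi_trudi (Suc t) a b)
      = fdet n (\<lambda>i j. jacobi_trudi (Suc t) a b i j - jacobi_trudi (Suc t) a b (Suc i) j)"
    by (rule fdet_row_differences) (simp add: jacobi_trudi_def hnum_def assms(2))
  also have "\<dots> = fdet n (\<lambda>i j. \<Sum>c\<in>{a (Suc i)..a i}. hnum t ((int c - int i) - (int (b j) - int j)))"
  proof (rule fdet_cong)
    fix i j
    have "a (Suc i) \<le> a i"
      using assms(1) by (simp add: decseq_SucD)
    \<comment> \<open>The step from \<open>i\<close> to \<open>Suc i\<close> in the index supplies
      the \<open>- 1\<close> at the lower end in \<open>sum_hnum\<close>.\<close>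
    from sum_hnum[OF this, of t "int i + (int (b j) - int j)"]
    show "jacobi_trudi (Suc t) a b i j - jacobi_trudi (Suc t) a b (Suc i) j
        = (\<Sum>c\<in>{a (Suc i)..a i}. hnum t ((int c - int i) - (int (b j) - int j)))"
      by (simp add: jacobi_trudi_def algebra_simps)
  qed
  also have "\<dots> = (\<Sum>c\<in>strips n a. fdet n (jacobi_trudi t c b))"
    by (subst fdet_sum_rows) (auto simp: jacobi_trudi_def[abs_def] strips_def)
  finally show ?thesis .
qed

text \<open>The recursion also runs over strips whose inner shape does not contain \<open>b\<close>;
  this shows that they contribute 0. Rows from \<open>k\<close> on and columns up to
  \<open>k\<close> form a block of negative indices.\<close>

lemma fdet_jacobi_trudi_not_contained:
  assumes "decseq a" "decseq b" "k < n" "a k < b k"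
  shows "fdet n (jacobi_trudi t a b) = 0"
proof (rule fdet_zero_block[OF assms(3)])
  fix i j
  assume "k \<le> i" "j \<le> k"
  then show "jacobi_trudi t a b i j = 0"
    using assms(4) decseqD[OF assms(1), of k i] decseqD[OF assms(2), of j k]
    by (simp add: jacobi_trudi_def hnum_def)
qed

text \<open>With no variables only index 0 gives 1, so the matrix is unitriangular for the empty
  skew shape and otherwise has a zero row, the first one in which \<open>a\<close> and
  \<open>b\<close> differ.\<close>

lemma fdet_jacobi_trudi_0:
  assumes a: "decseq a" and b: "decseq b" and ab: "\<And>i. i < n \<Longrightarrow> b i \<le> a i"
  shows "fdet n (jacobi_trudi 0 a b) = of_nat (card (tableaux 0 (shape n a b)))"
proof (cases "\<forall>i<n. a i = b i")
  case True
  then have "shape n a b = {}"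
    by (auto simp: shape_def)
  then have "tableaux 0 (shape n a b) = {\<lambda>_. 0}"
    by (auto simp: tableaux_def ssyt_def)
  moreover have "fdet n (jacobi_trudi 0 a b) = (\<Prod>i<n. jacobi_trudi 0 a b i i)"
  proof (rule fdet_upper_triangular)
    fix i j
    assume "i < n" "j < i"
    then show "jacobi_trudi 0 a b i j = 0"
      using True decseqD[OF b, of j i] by (simp add: jacobi_trudi_def hnum_def)
  qed
  moreover have "jacobi_trudi 0 a b i i = 1" if "i < n" for i
    using True that by (simp add: jacobi_trudi_def hnum_def)
  ultimately show ?thesis
    by simp
next
  case False
  define k where "k = (LEAST i. i < n \<and> a i \<noteq> b i)"
  have k: "k < n" "a k \<noteq> b k"
    using False LeastI_ex[of "\<lambda>i. i < n \<and> a i \<noteq> b i"] unfolding k_def by auto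
  have below: "a i = b i" if "i < k" for i
    using not_less_Least[of i "\<lambda>i. i < n \<and> a i \<noteq> b i"] that k(1) unfolding k_def by auto
  have "jacobi_trudi 0 a b k j = 0" if "j < n" for j
  proof -
    \<comment> \<open>For \<open>j < k\<close> the right-hand side is \<open>a j - j\<close> and
      thus larger; for \<open>j \<ge> k\<close> it is at most \<open>b k - k\<close> and thus
      smaller.\<close>
    have "int (a k) - int k \<noteq> int (b j) - int j"
      using below[of j] decseqD[OF a, of j k] decseqD[OF b, of k j] ab[OF k(1)] k(2)
      by (cases "j < k") auto
    then show ?thesis
      by (auto simp: jacobi_trudi_def hnum_def pochhammer_0_left)
  qed
  moreover obtain m where "n = Suc m"
    using k(1) by (cases n) auto
  ultimately have "fdet n (jacobi_trudi 0 a b) = 0"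
    using k(1) by (simp add: fdet_row[of k])
  moreover have "(Suc k, a k) \<in> shape n a b"
    using k ab[OF k(1)] by (simp add: Suc_in_shape)
  then have "tableaux 0 (shape n a b) = {}"
    using tableauxD(1,2)[of _ 0 _ "(Suc k, a k)"] by fastforce
  ultimately show ?thesis
    by simp
qed

text \<open>The Jacobi-Trudi identity at \<open>t\<close> ones: both sides satisfy the same
  recursion in \<open>t\<close> over horizontal strips and agree at \<open>t = 0\<close>.\<close>

theorem card_tableaux_eq_fdet:
  assumes "decseq a" "\<And>i. n \<le> i \<Longrightarrow> a i = 0" "decseq b" "\<And>i. i < n \<Longrightarrow> b i \<le> a i"
  shows "of_nat (card (tableaux t (shape n a b))) = fdet n (jacobi_trudi t a b)"
  using assms
proof (induction t arbitrary: a)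
  case 0
  then show ?case
    by (simp add: fdet_jacobi_trudi_0)
next
  case (Suc t)
  let ?C = "\<lambda>c. \<forall>i<n. b i \<le> c i"
  have "fdet n (jacobi_trudi t c b) = (if ?C c then of_nat (card (tableaux t (shape n c b))) else 0)"
    if c: "c \<in> strips n a" for c
  proof -
    \<comment> \<open>Strips are \<open>undefined\<close> from \<open>n\<close> on; continuing by 0
      gives a decreasing sequence, as the induction hypothesis demands.\<close>
    define c' where "c' i = (if i < n then c i else 0)" for i
    have "c' (Suc i) \<le> c' i" for i
      using stripsD[OF c, of i] stripsD[OF c, of "Suc i"] by (auto simp: c'_def)
    then have dec: "decseq c'"
      by (simp add: decseq_Suc_iff)
    have eq: "fdet n (jacobi_trudi t c b) = fdet n (jacobi_trudi t c' b)"
      by (rule fdet_cong) (simp add: jacobi_trudi_def c'_def)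
    show ?thesis
    proof (cases "?C c")
      case True
      then have "of_nat (card (tableaux t (shape n c' b))) = fdet n (jacobi_trudi t c' b)"
        by (intro Suc.IH dec Suc.prems(3)) (auto simp: c'_def)
      moreover have "shape n c' b = shape n c b"
        by (rule shape_cong) (simp add: c'_def)
      ultimately show ?thesis
        using True eq by simp
    next
      case False
      then obtain k where "k < n" "c' k < b k"
        by (auto simp: c'_def not_le)
      then show ?thesis
        using False eq fdet_jacobi_trudi_not_contained[OF dec Suc.prems(3)] by auto
    qed
  qed
  then have "fdet n (jacobi_trudi (Suc t) a b)
      = (\<Sum>c\<in>strips n a. if ?C c then of_nat (card (tableaux t (shape n c b))) else 0)"
    using Suc.prems by (simp add: fdet_jacobi_trudi_Suc)
  also have "\<dots> = (\<Sum>c | c \<in> strips n a \<and> ?C c. of_nat (card (tableaux t (shape n c b))))"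
    by (simp add: sum.inter_filter finite_strips)
  finally show ?case
    using Suc.prems by (simp add: card_tableaux_Suc)
qed

section \<open>The rank\<close>

definition boundary :: "nat \<Rightarrow> (nat \<Rightarrow> nat) \<Rightarrow> int set" where
  "boundary n a = (\<lambda>i. int (a i) - int i) ` {..<n}"

text \<open>Row \<open>Suc k\<close> of \<open>shape n a b\<close> ends at content \<open>a k - Suc k\<close>, one less than the element
  of \<open>boundary n a\<close> it contributes.\<close>

lemma first_on_diagonal:
  assumes a: "decseq a" and b: "decseq b"
    and s: "(i, j) \<in> shape n a b" and first: "(i - 1, j - 1) \<notin> shape n a b"
  shows "(i, j - 1) \<in> shape n a b \<longleftrightarrow> int j - int i \<notin> boundary n b"
    and "(i - 1, j) \<in> shape n a b \<longleftrightarrow> int j - int i + 1 \<in> boundary n b"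
proof -
  obtain k where k: "i = Suc k" "k < n" "b k < j" "j \<le> a k"
    using s by (rule shapeE)
  \<comment> \<open>The row above extends to column \<open>j - 1\<close> on the outer side, so
    \<open>(i - 1, j - 1)\<close> can only be missing on the inner side.\<close>
  have above: "j - 1 \<le> b (k - 1)" if "k \<noteq> 0"
  proof (rule ccontr)
    assume "\<not> j - 1 \<le> b (k - 1)"
    moreover have "a k \<le> a (k - 1)"
      using a by (simp add: decseqD)
    ultimately have "(k, j - 1) \<in> shape n a b"
      using that k by (auto simp: shape_def)
    with first k show False
      by simp
  qed
  have above': "j \<le> Suc (b l)" if "l < k" for l
    using above decseqD[OF b, of l "k - 1"] that by force
  have below: "b l \<le> b k" if "k \<le> l" for l
    using that b by (simp add: decseqD)
  have "int j - int i \<in> boundary n b \<longleftrightarrow> j = Suc (b k)"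
  proof
    assume "int j - int i \<in> boundary n b"
    then obtain l where l: "l < n" "int j - int i = int (b l) - int l"
      by (auto simp: boundary_def)
    \<comment> \<open>Rows above give elements larger than the content \<open>j - i\<close>, rows
      below smaller ones.\<close>
    have "l = k"
      using above'[of l] below[of l] l k by (cases l k rule: linorder_cases) auto
    with l k show "j = Suc (b k)"
      by auto
  qed (use k in \<open>auto simp: boundary_def intro!: image_eqI[of _ _ k]\<close>)
  moreover have "(i, j - 1) \<in> shape n a b \<longleftrightarrow> j \<noteq> Suc (b k)"
    using k by (auto simp: Suc_in_shape)
  ultimately show "(i, j - 1) \<in> shape n a b \<longleftrightarrow> int j - int i \<notin> boundary n b"
    by blast
  have "int j - int i + 1 \<in> boundary n b \<longleftrightarrow> k \<noteq> 0 \<and> j = Suc (b (k - 1))"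
  proof
    assume "int j - int i + 1 \<in> boundary n b"
    then obtain l where l: "l < n" "int j - int i + 1 = int (b l) - int l"
      by (auto simp: boundary_def)
    \<comment> \<open>By the same comparison only index \<open>k - 1\<close> can give
      \<open>j - i + 1\<close>.\<close>
    have "Suc l = k"
    proof (rule ccontr)
      assume "Suc l \<noteq> k"
      then show False
        using above'[of "Suc l"] decseqD[OF b, of l "Suc l"] below[of l] l k
        by (cases "l < k") auto
    qed
    with l k show "k \<noteq> 0 \<and> j = Suc (b (k - 1))"
      by auto
  qed (use k in \<open>auto simp: boundary_def intro!: image_eqI[of _ _ "k - 1"]\<close>)
  moreover have "(i - 1, j) \<in> shape n a b \<longleftrightarrow> k \<noteq> 0 \<and> j = Suc (b (k - 1))"
    using k above decseqD[OF a, of "k - 1" k] by (cases k) (auto simp: Suc_in_shape elim: shapeE)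
  ultimately show "(i - 1, j) \<in> shape n a b \<longleftrightarrow> int j - int i + 1 \<in> boundary n b"
    by blast
qed

text \<open>The square of the shape farthest up and left on the same diagonal serves.\<close>

lemma diagonal_first_square:
  assumes "(i, j) \<in> shape n a b"
  obtains p u v where "i = u + p" "j = v + p" "(u, v) \<in> shape n a b" "(u - 1, v - 1) \<notin> shape n a b"
proof -
  define Q where "Q p = ((i - p, j - p) \<in> shape n a b \<and> p \<le> i \<and> p \<le> j)" for p
  have "Q 0"
    using assms by (simp add: Q_def)
  moreover have "p \<le> i" if "Q p" for p
    using that by (simp add: Q_def)
  ultimately have G: "Q (Greatest Q)" "\<And>p. Q p \<Longrightarrow> p \<le> Greatest Q"
    by (blast intro: GreatestI_nat Greatest_le_nat)+
  define p where "p = Greatest Q"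
  have "(i - p - 1, j - p - 1) \<notin> shape n a b"
  proof
    assume *: "(i - p - 1, j - p - 1) \<in> shape n a b"
    then have "Q (Suc p)"
      by (auto simp: Q_def shape_def)
    with G(2)[of "Suc p"] show False
      by (simp add: p_def)
  qed
  with G(1) show ?thesis
    by (intro that[of "i - p" p "j - p"]) (auto simp: Q_def p_def)
qed

text \<open>Content is constant along a diagonal and every square lies on the diagonal from a first
  square, so corners singled out by content reach all squares of such content.\<close>

lemma union_of_diagonals:
  assumes "C = {(i, j). (i, j) \<in> shape n a b \<and> (i - 1, j - 1) \<notin> shape n a b \<and> P (int j - int i)}"
  shows "(\<Union>c\<in>C. diagonal_from (shape n a b) c) = {(i, j) \<in> shape n a b. P (int j - int i)}"
proof (intro equalityI subsetI)
  fix s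
  assume "s \<in> (\<Union>c\<in>C. diagonal_from (shape n a b) c)"
  then show "s \<in> {(i, j) \<in> shape n a b. P (int j - int i)}"
    by (auto simp: diagonal_from_def assms)
next
  fix s
  assume "s \<in> {(i, j) \<in> shape n a b. P (int j - int i)}"
  then obtain i j where s: "s = (i, j)" "(i, j) \<in> shape n a b" "P (int j - int i)"
    by auto
  obtain p u v where "i = u + p" "j = v + p" "(u, v) \<in> shape n a b" "(u - 1, v - 1) \<notin> shape n a b"
    using s(2) by (rule diagonal_first_square)
  with s show "s \<in> (\<Union>c\<in>C. diagonal_from (shape n a b) c)"
    by (auto simp: diagonal_from_def assms intro!: bexI[of _ "(u, v)"])
qed

text \<open>The difference of the indicators of the outer and the inner diagonals telescopes along each row.\<close>

lemma d_plus_minus_d_minus: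
  assumes a: "decseq a" and b: "decseq b" and ab: "\<And>i. i < n \<Longrightarrow> b i \<le> a i"
  shows "int (d_plus (shape n a b)) - int (d_minus (shape n a b))
    = int (card {i \<in> {..<n}. int (a i) - int i \<notin> boundary n b})"
proof -
  let ?D = "shape n a b" and ?M = "boundary n b"
  \<comment> \<open>For this indicator, \<open>\<chi> c - \<chi> (c + 1)\<close> is 1 on outer
    diagonals, -1 on inner ones and 0 elsewhere.\<close>
  define \<chi> where "\<chi> c = (if c \<in> ?M then 1 else 0 :: int)" for c
  define O' where "O' = {(i, j) \<in> ?D. int j - int i \<in> ?M \<and> int j - int i + 1 \<notin> ?M}"
  define I' where "I' = {(i, j) \<in> ?D. int j - int i \<notin> ?M \<and> int j - int i + 1 \<in> ?M}"
  have "outer_corners ?D = {(i, j). (i, j) \<in> ?D \<and> (i - 1, j - 1) \<notin> ?D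
      \<and> (int j - int i \<in> ?M \<and> int j - int i + 1 \<notin> ?M)}"
    using first_on_diagonal[OF a b] unfolding outer_corners_def by blast
  then have "d_plus ?D = card O'"
    unfolding d_plus_def O'_def by (rule arg_cong[OF union_of_diagonals])
  moreover have "inner_corners ?D = {(i, j). (i, j) \<in> ?D \<and> (i - 1, j - 1) \<notin> ?D
      \<and> (int j - int i \<notin> ?M \<and> int j - int i + 1 \<in> ?M)}"
    using first_on_diagonal[OF a b] unfolding inner_corners_def by blast
  then have "d_minus ?D = card I'"
    unfolding d_minus_def I'_def by (rule arg_cong[OF union_of_diagonals])
  moreover have "int (card O') - int (card I')
      = (\<Sum>(i, j)\<in>?D. \<chi> (int j - int i) - \<chi> (int j - int i + 1))"
  proof -
    have "int (card O') = (\<Sum>s\<in>?D. if s \<in> O' then 1 else 0)"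
      "int (card I') = (\<Sum>s\<in>?D. if s \<in> I' then 1 else 0)"
      by (auto simp: O'_def I'_def finite_shape simp flip: sum.inter_filter intro!: arg_cong[where f = card])
    then show ?thesis
      unfolding sum_subtractf[symmetric]
      by (auto simp: O'_def I'_def \<chi>_def simp flip: sum_subtractf intro!: sum.cong)
  qed
  moreover have "(\<Sum>(i, j)\<in>?D. \<chi> (int j - int i) - \<chi> (int j - int i + 1))
      = (\<Sum>k<n. \<Sum>j\<in>{b k<..a k}. \<chi> (int j - int (Suc k)) - \<chi> (int j - int (Suc k) + 1))"
  proof -
    have "bij_betw (\<lambda>(k, j). (Suc k, j)) (SIGMA k:{..<n}. {b k<..a k}) ?D"
      by (rule bij_betw_imageI) (auto simp: inj_on_def Suc_in_shape image_iff elim!: shapeE)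
    from sum.reindex_bij_betw[OF this, of "\<lambda>(i, j). \<chi> (int j - int i) - \<chi> (int j - int i + 1)"]
    show ?thesis
      by (subst sum.Sigma) (simp_all only: split_def fst_conv snd_conv, simp_all)
  qed
  moreover have "(\<Sum>j\<in>{b k<..a k}. \<chi> (int j - int (Suc k)) - \<chi> (int j - int (Suc k) + 1))
      = (if int (a k) - int k \<notin> ?M then 1 else 0)" if "k < n" for k
  proof -
    have "(\<Sum>j\<in>{b k<..a k}. \<chi> (int j - int (Suc k)) - \<chi> (int j - int (Suc k) + 1))
        = (\<Sum>j = b k..<a k. \<chi> (int j - int k) - \<chi> (int (Suc j) - int k))"
      by (rule sum.reindex_bij_witness[of _ Suc "\<lambda>j. j - 1"]) (auto simp: algebra_simps of_nat_diff)
    also have "\<dots> = - (\<Sum>j = b k..<a k. \<chi> (int (Suc j) - int k) - \<chi> (int j - int k))"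
      by (simp add: sum_subtractf)
    also have "\<dots> = \<chi> (int (b k) - int k) - \<chi> (int (a k) - int k)"
      using sum_Suc_diff'[OF ab[OF that], of "\<lambda>j. \<chi> (int j - int k)"] by simp
    \<comment> \<open>The lower end \<open>b k - k\<close> is itself in \<open>boundary n b\<close>,
      so its indicator is 1.\<close>
    finally show ?thesis
      using that by (auto simp: \<chi>_def boundary_def)
  qed
  ultimately show ?thesis
    by (simp add: sum.If_cases Int_def)
qed

section \<open>The order of vanishing at zero\<close>

lemma poly_pochhammer: "poly (pochhammer p k) x = pochhammer (poly p x) k"
  by (induction k) (simp_all add: pochhammer_Suc)

definition hpoly :: "int \<Rightarrow> rat poly" where
  "hpoly k = (if k < 0 then 0 else Polynomial.smult (1 / fact (nat k)) (pochhammer [:0, 1:] (nat k)))"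

lemma poly_hpoly: "poly (hpoly k) (of_nat t) = hnum t k"
  by (simp add: hpoly_def hnum_def poly_pochhammer)

lemma poly_hpoly_0: "poly (hpoly k) 0 = (if k = 0 then 1 else 0)"
  by (auto simp: hpoly_def poly_pochhammer pochhammer_0_left)

text \<open>The quotient of \<open>hpoly k\<close> by the variable for \<open>k \<noteq> 0\<close>.
  At \<open>k = 0\<close>, where \<open>hpoly k\<close> is 1, the value 0 is only a default.\<close>

definition hpoly_quot :: "int \<Rightarrow> rat poly" where
  "hpoly_quot k = (if k \<le> 0 then 0 else Polynomial.smult (1 / fact (nat k)) (pochhammer [:1, 1:] (nat k - 1)))"

lemma hpoly_quot:
  assumes "k \<noteq> 0"
  shows "hpoly k = [:0, 1:] * hpoly_quot k"
proof (cases "k < 0")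
  case False
  then obtain m where k: "k = int (Suc m)"
    using assms by (metis linorder_neqE pos_int_cases Suc_pred)
  have "pochhammer [:0, 1 :: rat:] (Suc m) = [:0, 1:] * pochhammer ([:0, 1:] + 1) m"
    by (rule pochhammer_rec)
  also have "[:0, 1 :: rat:] + 1 = [:1, 1:]"
    by (simp add: one_pCons)
  finally show ?thesis
    by (simp add: hpoly_def hpoly_quot_def k nat_add_distrib)
qed (simp add: hpoly_def hpoly_quot_def)

text \<open>For positive \<open>k\<close> this is \<open>fact (k - 1) / fact k\<close>, the source
  of the Cauchy entries.\<close>

lemma poly_hpoly_quot_0: "poly (hpoly_quot k) 0 = (if 0 < k then 1 / of_int k else 0)"
proof (cases "k \<le> 0")
  case False
  then obtain m where "k = int (Suc m)"
    by (metis not_le pos_int_cases Suc_pred)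
  then show ?thesis
    by (simp add: hpoly_quot_def poly_pochhammer nat_add_distrib flip: pochhammer_fact)
qed (simp add: hpoly_quot_def)

definition jacobi_trudi_poly :: "(nat \<Rightarrow> nat) \<Rightarrow> (nat \<Rightarrow> nat) \<Rightarrow> nat \<Rightarrow> nat \<Rightarrow> rat poly" where
  "jacobi_trudi_poly a b i j = hpoly ((int (a i) - int i) - (int (b j) - int j))"

lemma poly_fdet_jacobi_trudi_poly:
  "poly (fdet n (jacobi_trudi_poly a b)) (of_nat t) = fdet n (jacobi_trudi t a b)"
  by (simp add: fdet_hom_poly jacobi_trudi_poly_def jacobi_trudi_def[abs_def] poly_hpoly)

text \<open>A row of the Jacobi-Trudi matrix without an entry 1 is divisible by \<open>t\<close>. Dividing these rows by
  \<open>t\<close> and putting \<open>t = 0\<close> leaves a restricted Cauchy matrix.\<close>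

lemma order_fdet_jacobi_trudi_poly:
  assumes a: "decseq a" and b: "decseq b" and ab: "\<And>i. i < n \<Longrightarrow> b i \<le> a i"
  shows "order 0 (fdet n (jacobi_trudi_poly a b))
    = card {i \<in> {..<n}. int (a i) - int i \<notin> boundary n b}"
proof -
  define l m where "l i = int (a i) - int i" and "m j = int (b j) - int j" for i j
  define U where "U = {i \<in> {..<n}. l i \<notin> boundary n b}"
  define R where "R i j = (if i \<in> U then hpoly_quot (l i - m j) else hpoly (l i - m j))" for i j
  define x y :: "nat \<Rightarrow> rat" where "x i = of_int (l i)" and "y j = of_int (m j)" for i j
  have M: "boundary n b = m ` {..<n}"
    by (simp add: boundary_def m_def)
  have mem_U: "i \<notin> U \<longleftrightarrow> x i \<in> y ` {..<n}" if "i < n" for i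
    using that by (auto simp: U_def M x_def y_def)
  have "fdet n (jacobi_trudi_poly a b)
      = fdet n (\<lambda>i j. (if i \<in> U then [:0, 1:] else 1) * 1 * R i j)"
  proof (rule fdet_cong)
    fix i j
    assume "i < n" "j < n"
    then have "l i \<noteq> m j" if "i \<in> U"
      using that by (auto simp: U_def M)
    then show "jacobi_trudi_poly a b i j = (if i \<in> U then [:0, 1:] else 1) * 1 * R i j"
      using hpoly_quot[of "l i - m j"] by (auto simp: jacobi_trudi_poly_def R_def l_def m_def)
  qed
  also have "\<dots> = (\<Prod>i<n. if i \<in> U then [:0, 1:] else 1) * fdet n R"
    by (subst fdet_scale) simp
  \<comment> \<open>The variable is written \<open>[:- 0, 1:]\<close>, the linear factor at the
    point 0 in the form that \<open>order_power_n_n\<close> expects.\<close>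
  also have "(\<Prod>i<n. if i \<in> U then [:0, 1:] else 1 :: rat poly) = [:- 0, 1:] ^ card U"
    by (simp add: U_def flip: prod.inter_filter)
  finally have det: "fdet n (jacobi_trudi_poly a b) = [:- 0, 1:] ^ card U * fdet n R" .
  have "poly (fdet n R) 0 = fdet n (matched_rcauchy n x y)"
    unfolding fdet_hom_poly
  proof (rule fdet_cong)
    fix i j
    assume "i < n" "j < n"
    then show "poly (R i j) 0 = matched_rcauchy n x y i j"
      using mem_U[of i]
      by (auto simp: R_def matched_rcauchy_def rcauchy_def poly_hpoly_0 poly_hpoly_quot_0 x_def y_def)
  qed
  also have "\<dots> \<noteq> 0"
  proof (rule matched_rcauchy_det_nonzero)
    show "x j < x i" "y j < y i" if "i < j" for i j
      using that decseqD[OF a, of i j] decseqD[OF b, of i j]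
      by (simp_all add: x_def y_def l_def m_def)
    show "y i \<le> x i" if "i < n" for i
      using ab[OF that] by (simp add: x_def y_def l_def m_def)
  qed
  finally have R: "poly (fdet n R) 0 \<noteq> 0" .
  then have "fdet n R \<noteq> 0"
    by auto
  then have "order 0 (fdet n (jacobi_trudi_poly a b)) = card U + order 0 (fdet n R)"
    unfolding det by (subst order_mult) (simp_all only: order_power_n_n, simp)
  with R show ?thesis
    by (simp add: order_0I U_def l_def)
qed

section \<open>Specialization of the skew Schur series\<close>

definition tableau_content :: "(nat \<times> nat) set \<Rightarrow> (nat \<times> nat \<Rightarrow> nat) \<Rightarrow> nat \<Rightarrow>\<^sub>0 nat" where
  "tableau_content D T = Abs_poly_mapping (\<lambda>k. card {s \<in> D. T s = k})"

lemma lookup_tableau_content: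
  assumes "finite D"
  shows "Poly_Mapping.lookup (tableau_content D T) k = card {s \<in> D. T s = k}"
proof -
  have "{k. card {s \<in> D. T s = k} \<noteq> 0} \<subseteq> T ` D"
    by (auto simp: card_eq_0_iff)
  then have "finite {k. card {s \<in> D. T s = k} \<noteq> 0}"
    using assms by (auto intro: finite_subset)
  then show ?thesis
    by (simp add: tableau_content_def)
qed

lemma keys_tableau_content:
  assumes "finite D"
  shows "Poly_Mapping.keys (tableau_content D T) = T ` D"
proof -
  have "k \<in> Poly_Mapping.keys (tableau_content D T) \<longleftrightarrow> k \<in> T ` D" for k
    using assms by (auto simp: in_keys_iff lookup_tableau_content card_eq_0_iff)
  then show ?thesis
    by blast
qed

text \<open>The substitution gives weight 1 to the monomials in the first \<open>t\<close> variables
  and 0 to all others; the remaining coefficients count, content by content, the tableaux with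
  entries up to \<open>t\<close>.\<close>

lemma series_eval_skew_schur:
  assumes fin: "finite (skew_diagram lam mu)"
  shows "series_eval (skew_schur lam mu) (ones t) = of_nat (card (tableaux t (skew_diagram lam mu)))"
proof -
  define D where "D = skew_diagram lam mu"
  note fin = fin[folded D_def]
  define W where "W \<alpha> = (\<Prod>i\<in>Poly_Mapping.keys \<alpha>. ones t i ^ Poly_Mapping.lookup \<alpha> i)"
    for \<alpha> :: "nat \<Rightarrow>\<^sub>0 nat"
  have W: "W \<alpha> = (if Poly_Mapping.keys \<alpha> \<subseteq> {1..t} then 1 else 0)" for \<alpha>
  proof (cases "Poly_Mapping.keys \<alpha> \<subseteq> {1..t}")
    case True
    then show ?thesis
      unfolding W_def by (auto simp: ones_def subset_iff intro!: prod.neutral)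
  next
    case False
    then obtain i where i: "i \<in> Poly_Mapping.keys \<alpha>" "i \<notin> {1..t}"
      by blast
    then have "ones t i ^ Poly_Mapping.lookup \<alpha> i = 0"
      by (auto simp: ones_def in_keys_iff)
    with False i show ?thesis
      unfolding W_def by (auto intro!: prod_zero)
  qed
  have content: "(\<forall>k. card {s \<in> D. T s = k} = Poly_Mapping.lookup \<alpha> k) \<longleftrightarrow> tableau_content D T = \<alpha>"
    for T \<alpha>
    by (auto simp: poly_mapping_eq_iff fun_eq_iff lookup_tableau_content fin)
  have small: "T \<in> tableaux t D \<longleftrightarrow> T \<in> ssyt D \<and> Poly_Mapping.keys (tableau_content D T) \<subseteq> {1..t}" for T
    unfolding keys_tableau_content[OF fin] by (auto simp: tableaux_def ssyt_def)
  have weighted_card: "skew_schur lam mu \<alpha> * W \<alpha> = of_nat (card {T \<in> tableaux t D. tableau_content D T = \<alpha>})" for \<alpha>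
  proof -
    have "{T \<in> tableaux t D. tableau_content D T = \<alpha>}
        = (if Poly_Mapping.keys \<alpha> \<subseteq> {1..t} then {T \<in> ssyt D. tableau_content D T = \<alpha>} else {})"
      by (auto simp: small)
    then show ?thesis
      unfolding W skew_schur_def D_def[symmetric] content by auto
  qed
  have finT: "finite (tableaux t D)"
    using fin by (rule finite_tableaux)
  have "series_eval (skew_schur lam mu) (ones t)
      = Sum_any (\<lambda>\<alpha>. of_nat (card {T \<in> tableaux t D. tableau_content D T = \<alpha>}))"
    unfolding series_eval_def W_def[symmetric] weighted_card ..
  also have "\<dots> = (\<Sum>\<alpha>\<in>tableau_content D ` tableaux t D.
      of_nat (card {T \<in> tableaux t D. tableau_content D T = \<alpha>}))"
    by (rule Sum_any.expand_superset) (auto simp: finT card_eq_0_iff)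
  also have "\<dots> = of_nat (card (tableaux t D))"
    using sum.image_gen[OF finT, of "\<lambda>_. 1 :: rat" "tableau_content D"] by simp
  finally show ?thesis
    by (simp add: D_def)
qed

text \<open>Otherwise the difference would be a nonzero polynomial with infinitely many roots. This
  gives the uniqueness behind \<open>skew_schur_poly\<close>.\<close>

lemma poly_eqI_of_nat:
  fixes p q :: "'a::{idom, ring_char_0} poly"
  assumes "\<And>t. poly p (of_nat t) = poly q (of_nat t)"
  shows "p = q"
proof (rule ccontr)
  assume "p \<noteq> q"
  then have "finite {x. poly (p - q) x = 0}"
    using poly_roots_finite[of "p - q"] by simp
  moreover have "range of_nat \<subseteq> {x. poly (p - q) x = 0}"
    using assms by auto
  ultimately have "finite (range (of_nat :: nat \<Rightarrow> 'a))"
    by (metis finite_subset)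
  then show False
    by (simp add: finite_image_iff inj_of_nat)
qed

section \<open>Partitions as sequences padded with zeros\<close>

definition part :: "nat list \<Rightarrow> nat \<Rightarrow> nat" where
  "part lam i = (if i < length lam then lam ! i else 0)"

lemma decseq_part:
  assumes "is_partition lam"
  shows "decseq (part lam)"
proof (rule decseq_SucI)
  show "part lam (Suc i) \<le> part lam i" for i
    using assms by (auto simp: part_def is_partition_def sorted_wrt_iff_nth_less)
qed

lemma skew_diagram_eq_shape:
  "skew_diagram lam mu = shape (length lam) (part lam) (part mu)"
  by (auto simp: skew_diagram_def young_diagram_def shape_def part_def split: if_splits)

text \<open>The last square of each row of \<open>mu\<close> lies in the diagram of
  \<open>lam\<close>; it exists because the parts of a partition are positive.\<close>

lemma part_mono:
  assumes "is_partition mu" "young_diagram mu \<subseteq> young_diagram lam"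
  shows "part mu i \<le> part lam i"
proof (cases "i < length mu")
  case True
  then have "mu ! i \<noteq> 0"
    using assms(1) by (metis is_partition_def nth_mem)
  then have "(Suc i, mu ! i) \<in> young_diagram mu"
    using True by (simp add: young_diagram_def)
  then have "(Suc i, mu ! i) \<in> young_diagram lam"
    using assms(2) by blast
  with True show ?thesis
    by (simp add: young_diagram_def part_def)
qed (simp add: part_def)

theorem theorem3p2:
  fixes lam mu :: "nat list"
  assumes "is_partition lam" and "is_partition mu"
    and "young_diagram mu \<subseteq> young_diagram lam"
  shows "int (zrank lam mu) = skew_rank lam mu"
proof -
  define n where "n = length lam"
  define a where "a = part lam"
  define b where "b = part mu"
  have a: "decseq a" "\<And>i. n \<le> i \<Longrightarrow> a i = 0"
    using decseq_part[OF assms(1)] by (auto simp: a_def n_def part_def)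
  have b: "decseq b"
    using decseq_part[OF assms(2)] by (simp add: b_def)
  have ab: "b i \<le> a i" for i
    using part_mono[OF assms(2,3)] by (simp add: a_def b_def)
  have D: "skew_diagram lam mu = shape n a b"
    by (simp add: skew_diagram_eq_shape n_def a_def b_def)
  have "poly (fdet n (jacobi_trudi_poly a b)) (of_nat t) = series_eval (skew_schur lam mu) (ones t)" for t
    using card_tableaux_eq_fdet[OF a b ab]
    by (simp add: poly_fdet_jacobi_trudi_poly series_eval_skew_schur D finite_shape)
  then have "skew_schur_poly lam mu = fdet n (jacobi_trudi_poly a b)"
    unfolding skew_schur_poly_def by (intro the_equality) (auto intro!: poly_eqI_of_nat)
  then show ?thesis
    using order_fdet_jacobi_trudi_poly[OF a(1) b ab] d_plus_minus_d_minus[OF a(1) b ab]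
    by (simp add: zrank_def skew_rank_def D)
qed

end
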